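(* Let $q\equiv1\pmod 4$ and let $A$ be a multiplicative character of $\mathbb{F}_q$ with $A^2\notin\{\varepsilon,\varphi,\chi_4,\overline{\chi_4}\}$. Put $N=g(A^2\chi_4)\,g(\overline{A^2}\chi_4)$ and let $F(t)={}_4F_3(A^2,A^2\varphi,A^2\chi_4,A^2\overline{\chi_4};\,A^4\varphi,A^4,\varphi\mid t)$. Then for every $x\in\mathbb{F}_q$ with $x\neq0,1$: (i) \begin{align*} F(4x(1-x))&=\frac{(\overline{A^4}\varphi)(2)}{g(\varphi)\,N}\left(\frac{1+\varphi(1-x)}{2}\right)\left(\frac{1+\varphi(x)}{2}\right)\Big(\overline{A^4}(1+\sqrt{1-x})+\overline{A^4}(1-\sqrt{1-x})\Big)\\ &\qquad\times\Big(\overline{A^4}(1+\sqrt{x})+\overline{A^4}(1-\sqrt{x})\Big)-\frac{(A^2\varphi)(x)\,(\overline{A^4}\varphi)(2)\,\overline{A^6}(x-1)\,g(\varphi)}{q\,N}\,\delta\!\left(\frac{1-2x}{(1-x)^2}\right); \end{align*} (ii) \begin{align*} F\!\left(\frac{-4x}{(1-x)^2}\right)&=\frac{(\overline{A^4}\varphi)(2)}{g(\varphi)\,N}\cdot\frac{(1+\varphi(1-x))(1+\varphi(x^2-x))}{4}\Big(\overline{A^4}\big(1+\tfrac{1}{\sqrt{1-x}}\big)+\overline{A^4}\big(1-\tfrac{1}{\sqrt{1-x}}\big)\Big)\\ &\qquad\times\Big(\overline{A^4}\big(1+\sqrt{\tfrac{x}{x-1}}\big)+\overline{A^4}\big(1-\sqrt{\tfrac{x}{x-1}}\big)\Big)-\frac{(A^2\varphi)(x)\,(\overline{A^4}\varphi)(2)\,(A^4\varphi)(x-1)\,g(\varphi)}{q\,N}\,\delta(1-x^2).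 \end{align*}
   Context: Let $p$ be an odd prime, $q=p^r$, and $\mathbb{F}_q$ the field with $q$ elements. Multiplicative characters of $\mathbb{F}_q^\times$ are extended to $\mathbb{F}_q$ by $\chi(0)=0$ (including the trivial character $\varepsilon$). $\varphi$ is the quadratic character and, when $q\equiv1\pmod4$, $\chi_4$ is a fixed character of order $4$. Characters are multiplied pointwise, $\overline{A}$ is the inverse of $A$, and $(\overline{A^4}\varphi)(2)$ etc. means the product character evaluated at that element. For $x\in\mathbb{F}_q$, $\delta(x)=1$ if $x=0$ and $0$ otherwise. Square roots $\sqrt{\cdot}$ denote any square root in $\mathbb{F}_q$ (the expressions are independent of the choice); whenever one of the relevant elements is not a square, the accompanying factor $1+\varphi(\cdot)$ vanishes and the whole product term is interpreted as $0$. The Gauss sum is $g(\chi)=\sum_{x\in\mathbb{F}_q}\chi(x)\theta(x)$ with $\theta(\alpha)=\zeta_p^{\mathrm{tr}(\alpha)}$, $\zeta_p$ a fixed primitive $p$-th root of unity, $\mathrm{tr}$ the trace to $\mathbb{F}_p$. The binomial coefficient is $\binom{A}{B}=\frac{B(-1)}{q}\sum_{x\in\mathbb{F}_q}A(x)\overline{B}(1-x)$. Greene's series: ${}_{n+1}F_n(A_0,\dots,A_n;\,B_1,\dots,B_n\mid x)=\frac{q}{q-1}\sum_{\chi}\binom{A_0\chi}{\chi}\prod_{i=1}^n\binom{A_i\chi}{B_i\chi}\chi(x)$, summed over all multiplicative characters $\chi$. *)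

theory Defs
  imports Complex_Main "HOL-Library.Function_Division" "HOL-Library.Cardinality"
    "HOL-Computational_Algebra.Primes"
begin

text \<open>
  The finite field is a type \<open>'a :: finite_field\<close> with \<open>q = CARD('a)\<close>. Characters are functions
  \<open>'a \<Rightarrow> complex\<close>; products, powers and inverses of characters are the pointwise ones of
  \<open>HOL-Library.Function_Algebras\<close> and \<open>HOL-Library.Function_Division\<close>. Since \<open>inverse 0 = 0\<close>, the
  extension by \<open>0\<close> at \<open>0\<close> is preserved by inverses and positive powers, but the zeroth power is the
  constant function \<open>1\<close>, not the trivial character.
\<close>

definition mult_char :: "('a :: field \<Rightarrow> complex) \<Rightarrow> bool" where
  "mult_char \<chi> \<longleftrightarrow> \<chi> 0 = 0 \<and> \<chi> 1 = 1 \<and> (\<forall>x y. \<chi> (x * y) = \<chi> x * \<chi> y)"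

definition triv_char :: "'a :: field \<Rightarrow> complex"  (\<open>\<epsilon>\<close>) where
  "\<epsilon> x = (if x = 0 then 0 else 1)"

definition quad_char :: "'a :: field \<Rightarrow> complex"  (\<open>\<phi>\<close>) where
  "\<phi> x = (if x = 0 then 0 else if \<exists>y. x = y ^ 2 then 1 else - 1)"

definition char_order :: "('a :: field \<Rightarrow> complex) \<Rightarrow> nat" where
  "char_order \<chi> = (LEAST n. n > 0 \<and> \<chi> ^ n = \<epsilon>)"

definition delta :: "'a :: field \<Rightarrow> complex"  (\<open>\<delta>\<close>) where
  "\<delta> x = (if x = 0 then 1 else 0)"

definition primitive_root_of_unity :: "nat \<Rightarrow> complex \<Rightarrow> bool" where
  "primitive_root_of_unity n \<zeta> \<longleftrightarrow> \<zeta> ^ n = 1 \<and> (\<forall>k. 0 < k \<and> k < n \<longrightarrow> \<zeta> ^ k \<noteq> 1)"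

text \<open>
  The trace of the field with \<open>p ^ r\<close> elements over its prime field, as the sum of the Frobenius
  conjugates. It takes values in the prime subfield, that is in the image of \<^const>\<open>of_nat\<close>, and
  \<open>add_char\<close> uses its least natural number representative as exponent.
\<close>

definition abs_trace :: "nat \<Rightarrow> nat \<Rightarrow> 'a :: field \<Rightarrow> 'a" where
  "abs_trace p r x = (\<Sum>i<r. x ^ (p ^ i))"

definition add_char :: "nat \<Rightarrow> nat \<Rightarrow> complex \<Rightarrow> 'a :: field \<Rightarrow> complex" where
  "add_char p r \<zeta> x = \<zeta> ^ (LEAST k. of_nat k = abs_trace p r x)"

definition gauss_sum :: "nat \<Rightarrow> nat \<Rightarrow> complex \<Rightarrow> ('a :: finite_field \<Rightarrow> complex) \<Rightarrow> complex" where
  "gauss_sum p r \<zeta> \<chi> = (\<Sum>x\<in>UNIV. \<chi> x * add_char p r \<zeta> x)"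

definition char_binom ::
    "('a :: finite_field \<Rightarrow> complex) \<Rightarrow> ('a \<Rightarrow> complex) \<Rightarrow> complex" where
  "char_binom A B = B (- 1) / of_nat CARD('a) * (\<Sum>x\<in>UNIV. A x * inverse B (1 - x))"

text \<open>
  \<open>greene_series [A\<^sub>0, \<dots>, A\<^sub>n] [B\<^sub>1, \<dots>, B\<^sub>n] x\<close>; note the shift between the numbering of
  the \<open>B\<^sub>i\<close> and the list positions.
\<close>

definition greene_series ::
    "('a :: finite_field \<Rightarrow> complex) list \<Rightarrow> ('a \<Rightarrow> complex) list \<Rightarrow> 'a \<Rightarrow> complex" where
  "greene_series As Bs x =
     of_nat CARD('a) / (of_nat CARD('a) - 1) *
     (\<Sum>\<chi> | mult_char \<chi>. char_binom (As ! 0 * \<chi>) \<chi> *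
        (\<Prod>i = 1..length Bs. char_binom (As ! i * \<chi>) (Bs ! (i - 1) * \<chi>)) * \<chi> x)"

text \<open>The index set of the sum above is finite, so that the sum is not the default value \<open>0\<close>.\<close>

lemma finite_mult_chars: "finite {\<chi> :: 'a :: finite_field \<Rightarrow> complex. mult_char \<chi>}"
proof -
  have pow: "x ^ (CARD('a) - 1) = 1" if "x \<noteq> 0" for x :: 'a
  proof -
    have "x ^ (CARD('a) - 1) * x = 1 * x"
      using finite_field_power_card_eq_same[of x] power_minus_mult[of "CARD('a)" x] by simp
    then show ?thesis using that by simp
  qed
  define S where "S x = {\<chi> x | \<chi> :: 'a \<Rightarrow> complex. mult_char \<chi>}" for x
  have fin: "finite (S x)" for x
  proof (cases "x = 0")
    case True
    then have "S x \<subseteq> {0}" by (auto simp: S_def mult_char_def)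
    then show ?thesis by (rule finite_subset) simp
  next
    case False
    obtain n where n: "n > 0" "x ^ n = 1"
      using pow[OF False] card_mono[of UNIV "{0, 1 :: 'a}"]
      by (intro that[of "CARD('a) - 1"]) auto
    have "\<chi> x ^ k = \<chi> (x ^ k)" if "mult_char \<chi>" for \<chi> :: "'a \<Rightarrow> complex" and k
      using that by (induction k) (simp_all add: mult_char_def)
    then have "\<chi> x ^ n = 1" if "mult_char \<chi>" for \<chi> :: "'a \<Rightarrow> complex"
      using that n(2) by (simp add: mult_char_def)
    then have "S x \<subseteq> {z. z ^ n = 1}"
      by (auto simp: S_def)
    then show ?thesis
      by (rule finite_subset) (rule finite_roots_unity, use n(1) in simp)
  qed
  have mem: "\<chi> x \<in> (\<Union>y. S y)" if "mult_char \<chi>" for \<chi> :: "'a \<Rightarrow> complex" and x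
  proof -
    have "\<chi> x \<in> S x" unfolding S_def using that by (intro CollectI exI[of _ \<chi>]) simp
    then show ?thesis by (rule UN_I[OF UNIV_I])
  qed
  have "finite (\<Union>y. S y)"
    using fin by simp
  from finite_set_of_finite_funs[OF finite[of UNIV] this]
  show ?thesis
    by (rule rev_finite_subset) (rule Collect_mono, intro allI impI conjI mem, assumption, simp)
qed

end

theory Submission
  imports Defs "HOL-Number_Theory.Residues" "HOL-Computational_Algebra.Polynomial"
begin

text \<open>
  Classically, \<open>(4a)\<^sub>4\<^sub>n / ((4a)\<^sub>2\<^sub>n (2n)!)\<close> are the even coefficients of an algebraic
  \<open>\<^sub>2F\<^sub>1\<close>. In the finite field, put \<open>C = A\<^sup>2\<close>. Writing the four binomials as Gauss sums and using
  the Hasse-Davenport relation for the quadratic character five times, the coefficient of \<open>\<chi>(t)\<close>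
  becomes a constant times \<open>\<chi>(1/16) g(C\<^sup>4\<chi>\<^sup>4) g(\<chi>\<^sup>-\<^sup>2) g(C\<^sup>-\<^sup>4\<chi>\<^sup>-\<^sup>2)\<close>. Expanding these Gauss
  sums and using orthogonality in \<open>\<chi>\<close>, the series collapses for every \<open>t \<noteq> 0\<close> to
  \<open>\<phi>(2) / (g(\<phi>) N)\<close> times the sum of \<open>C\<^sup>-\<^sup>4(1 + y)\<close> over the solutions of \<open>(y\<^sup>2 - 1)\<^sup>2 = t\<close>.
  For \<open>t = 4x(1 - x)\<close>, \<open>x = s\<^sup>2\<close> and \<open>1 - x = c\<^sup>2\<close> the solutions are \<open>\<plusminus>c \<plusminus> s\<close>, and
  \<open>(1 + c + s)\<^sup>2 = 2(1 + c)(1 + s)\<close> turns the sum into a product. For \<open>x = 1/2\<close> the solution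
  \<open>y = 0\<close> is counted twice by the product, or, when \<open>x\<close> is not a square, not at all: this is the delta
  term. The second identity is the first one at \<open>x / (x - 1)\<close>.
\<close>

section \<open>Multiplicative characters\<close>

lemma power_fun_apply [simp]: "(f ^ n) x = f x ^ n"
  for f :: "'b \<Rightarrow> 'c :: monoid_mult"
  by (induction n) simp_all

lemma mult_char_triv [intro]: "mult_char \<epsilon>"
  by (simp add: mult_char_def triv_char_def)

lemma mult_char_times [intro]: "mult_char \<chi> \<Longrightarrow> mult_char \<psi> \<Longrightarrow> mult_char (\<chi> * \<psi>)"
  by (simp add: mult_char_def)

lemma mult_char_inverse_fun [intro]: "mult_char \<chi> \<Longrightarrow> mult_char (inverse \<chi>)"
  by (simp add: mult_char_def)

lemma mult_char_power_fun [intro]: "mult_char \<chi> \<Longrightarrow> n > 0 \<Longrightarrow> mult_char (\<chi> ^ n)"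
  by (simp add: mult_char_def power_mult_distrib)

lemma mult_char_0 [simp]: "mult_char \<chi> \<Longrightarrow> \<chi> 0 = 0"
  and mult_char_1 [simp]: "mult_char \<chi> \<Longrightarrow> \<chi> 1 = 1"
  and mult_char_mult: "mult_char \<chi> \<Longrightarrow> \<chi> (x * y) = \<chi> x * \<chi> y"
  by (simp_all add: mult_char_def)

lemma mult_char_power: "mult_char \<chi> \<Longrightarrow> \<chi> (x ^ n) = \<chi> x ^ n"
  by (induction n) (simp_all add: mult_char_mult)

lemma mult_char_mult_inverse: "mult_char \<chi> \<Longrightarrow> x \<noteq> 0 \<Longrightarrow> \<chi> x * \<chi> (inverse x) = 1"
  by (subst mult_char_mult[symmetric]) simp_all

lemma mult_char_eq_0_iff: "mult_char \<chi> \<Longrightarrow> \<chi> x = 0 \<longleftrightarrow> x = 0"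
  using mult_char_mult_inverse[of \<chi> x] by (cases "x = 0") auto

lemma mult_char_inverse: "mult_char \<chi> \<Longrightarrow> \<chi> (inverse x) = inverse (\<chi> x)"
  using mult_char_mult_inverse[of \<chi> x] by (cases "x = 0") (simp, metis inverse_unique)

lemma mult_char_divide: "mult_char \<chi> \<Longrightarrow> \<chi> (x / y) = \<chi> x / \<chi> y"
  by (simp add: divide_inverse mult_char_mult mult_char_inverse)

lemma mult_char_minus_1_square: "mult_char \<chi> \<Longrightarrow> \<chi> (- 1) ^ 2 = 1"
  by (subst mult_char_power[symmetric]) simp_all

text \<open>Because \<open>inverse 0 = 0\<close>, the product is \<open>0\<close> at
  \<open>0\<close>. Cancelling characters therefore leaves \<open>\<epsilon>\<close>, not the
  constant \<open>1\<close> that is the unit of pointwise multiplication.\<close>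

lemma mult_char_times_inverse: "mult_char \<chi> \<Longrightarrow> \<chi> * inverse \<chi> = \<epsilon>"
  by (intro ext) (simp add: triv_char_def mult_char_eq_0_iff[of \<chi>])

lemma mult_char_times_triv: "mult_char \<chi> \<Longrightarrow> \<chi> * \<epsilon> = \<chi>"
  by (intro ext) (simp add: triv_char_def)

lemma mult_char_nontrivial:
  assumes "mult_char \<chi>" "\<chi> \<noteq> \<epsilon>"
  obtains a where "a \<noteq> 0" "\<chi> a \<noteq> 1"
proof -
  have "\<chi> = \<epsilon>" if "\<And>a. a \<noteq> 0 \<Longrightarrow> \<chi> a = 1"
    using that assms(1) by (intro ext) (simp add: triv_char_def)
  with assms(2) that show ?thesis by blast
qed

text \<open>Substituting \<open>a * x\<close> with \<open>\<chi> a \<noteq> 1\<close> multiplies the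
  sum by \<open>\<chi> a\<close>.\<close>

lemma sum_mult_char:
  fixes \<chi> :: "'a :: finite_field \<Rightarrow> complex"
  assumes "mult_char \<chi>" "\<chi> \<noteq> \<epsilon>"
  shows "sum \<chi> UNIV = 0"
proof -
  obtain a where a: "a \<noteq> 0" "\<chi> a \<noteq> 1"
    using assms by (rule mult_char_nontrivial)
  have "sum \<chi> UNIV = (\<Sum>x\<in>UNIV. \<chi> (a * x))"
    by (rule sum.reindex_bij_witness[of _ "\<lambda>x. a * x" "\<lambda>x. x / a"]) (use a in auto)
  also have "\<dots> = \<chi> a * sum \<chi> UNIV"
    using assms by (simp add: mult_char_mult sum_distrib_left)
  finally show ?thesis using a by simp
qed

section \<open>The cyclic multiplicative group, its dual and orthogonality\<close>

lemma finite_field_generator: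
  obtains \<gamma> :: "'a :: finite_field" where "\<gamma> \<noteq> 0" "\<And>x. x \<noteq> 0 \<Longrightarrow> \<exists>k. x = \<gamma> ^ k"
proof -
  \<comment> \<open>Cyclicity of the multiplicative group is a theorem on rings given as records, so
    the type is repackaged as one with carrier \<open>UNIV\<close>.\<close>
  define R :: "'a ring" where "R = \<lparr>carrier = UNIV, monoid.mult = (*), one = 1, ring.zero = 0, add = (+)\<rparr>"
  have inv: "\<exists>y. x + y = 0" for x :: 'a
    using add.right_inverse by blast
  have "x \<noteq> 0 \<Longrightarrow> \<exists>y. x * y = 1" for x :: 'a
    by (rule exI[of _ "inverse x"]) auto
  with inv have "field R" unfolding R_def
    by unfold_locales (auto simp: algebra_simps Units_def)
  then interpret field R .
  have fin: "finite (carrier R)" by (simp add: R_def)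
  have pow: "a [^]\<^bsub>R\<^esub> (k :: nat) = a ^ k" for a k
    by (induction k) (auto simp: R_def nat_pow_def mult_ac)
  obtain \<gamma> where "\<gamma> \<in> carrier (mult_of R)"
    "carrier (mult_of R) = {\<gamma> [^]\<^bsub>R\<^esub> i | i :: nat. i \<in> UNIV}"
    using finite_field_mult_group_has_gen[OF fin] by blast
  then show ?thesis
    by (intro that[of \<gamma>]) (auto simp: R_def pow[unfolded R_def])
qed

lemma power_CARD_minus_1:
  fixes x :: "'a :: finite_field"
  assumes "x \<noteq> 0"
  shows "x ^ (CARD('a) - 1) = 1"
  using finite_field_power_card_eq_same[of x] power_minus_mult[of "CARD('a)" x] assms by simp

lemma power_mod_period:
  fixes x :: "'b :: monoid_mult"
  assumes "x ^ n = 1"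
  shows "x ^ (k mod n) = x ^ k"
proof -
  have "x ^ k = x ^ (n * (k div n) + k mod n)" by simp
  also have "\<dots> = x ^ (k mod n)" by (simp only: power_add power_mult assms power_one mult_1_left)
  finally show ?thesis ..
qed

text \<open>By counting: the \<open>CARD('a) - 1\<close> powers with smallest exponents already
  reach every nonzero element, so they are pairwise distinct.\<close>

lemma generator_power_eq_iff:
  fixes \<gamma> :: "'a :: finite_field"
  assumes \<gamma>: "\<gamma> \<noteq> 0" "\<And>x. x \<noteq> 0 \<Longrightarrow> \<exists>k. x = \<gamma> ^ k"
  shows "\<gamma> ^ i = \<gamma> ^ j \<longleftrightarrow> i mod (CARD('a) - 1) = j mod (CARD('a) - 1)"
proof -
  define n where "n = CARD('a) - 1"
  have n: "n > 0" using card_mono[of UNIV "{0, 1 :: 'a}"] by (simp add: n_def)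
  have red: "\<gamma> ^ k = \<gamma> ^ (k mod n)" for k
    using power_mod_period[OF power_CARD_minus_1[OF \<gamma>(1)]] by (simp add: n_def)
  have "(\<lambda>k. \<gamma> ^ k) ` {..<n} = UNIV - {0}"
  proof (intro equalityI subsetI)
    fix x :: 'a assume "x \<in> UNIV - {0}"
    then obtain k where "x = \<gamma> ^ k" using \<gamma>(2) by blast
    then have "x = \<gamma> ^ (k mod n)" using red by simp
    then show "x \<in> (\<lambda>k. \<gamma> ^ k) ` {..<n}" using n by simp
  qed (use \<gamma>(1) in auto)
  then have "inj_on (\<lambda>k. \<gamma> ^ k) {..<n}"
    by (intro eq_card_imp_inj_on) (simp_all add: n_def card_Diff_singleton)
  then show ?thesis
    unfolding n_def[symmetric] using red[of i] red[of j] n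
    by (metis inj_onD lessThan_iff mod_less_divisor)
qed

text \<open>Equal powers of \<open>\<gamma>\<close> have exponents congruent modulo
  \<open>CARD('a) - 1\<close>, hence give equal powers of \<open>\<omega>\<close>. So
  \<open>\<omega>\<close> raised to a discrete logarithm is well defined, whichever logarithm
  \<open>SOME\<close> picks.\<close>

lemma ex_mult_char_of_generator:
  fixes \<gamma> :: "'a :: finite_field"
  assumes \<gamma>: "\<gamma> \<noteq> 0" "\<And>x. x \<noteq> 0 \<Longrightarrow> \<exists>k. x = \<gamma> ^ k"
    and \<omega>: "\<omega> ^ (CARD('a) - 1) = 1"
  obtains \<chi> where "mult_char \<chi>" "\<chi> \<gamma> = \<omega>"
proof -
  define n where "n = CARD('a) - 1"
  define lg where "lg x = (SOME k. x = \<gamma> ^ k)" for x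
  have lg: "x = \<gamma> ^ lg x" if "x \<noteq> 0" for x
    unfolding lg_def by (rule someI_ex) (rule \<gamma>(2)[OF that])
  have red: "\<omega> ^ k = \<omega> ^ (k mod n)" for k
    using power_mod_period[OF \<omega>] by (simp add: n_def)
  have pow: "\<omega> ^ i = \<omega> ^ j" if "\<gamma> ^ i = \<gamma> ^ j" for i j
    using that red[of i] red[of j] by (simp add: generator_power_eq_iff[OF \<gamma>] n_def)
  define \<chi> where "\<chi> x = (if x = 0 then 0 else \<omega> ^ lg x)" for x
  have \<chi>: "\<chi> (\<gamma> ^ k) = \<omega> ^ k" for k
    using pow[OF lg[of "\<gamma> ^ k", symmetric]] \<gamma>(1) by (simp add: \<chi>_def)
  have "\<chi> (x * y) = \<chi> x * \<chi> y" for x y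
  proof (cases "x = 0 \<or> y = 0")
    case False
    then obtain i j where "x = \<gamma> ^ i" "y = \<gamma> ^ j" using \<gamma>(2) by metis
    then show ?thesis by (simp add: \<chi> flip: power_add)
  qed (auto simp: \<chi>_def)
  then have "mult_char \<chi>"
    using \<chi>[of 0] unfolding mult_char_def by (simp add: \<chi>_def)
  then show ?thesis using that \<chi>[of 1] by simp
qed

text \<open>A character sending a generator to a primitive root of unity of order
  \<open>CARD('a) - 1\<close> is faithful.\<close>

lemma ex_mult_char_separating:
  fixes a :: "'a :: finite_field"
  assumes "a \<noteq> 0" "a \<noteq> 1"
  obtains \<chi> where "mult_char \<chi>" "\<chi> a \<noteq> 1"
proof -
  obtain \<gamma> :: 'a where \<gamma>: "\<gamma> \<noteq> 0" "\<And>x. x \<noteq> 0 \<Longrightarrow> \<exists>k. x = \<gamma> ^ k"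
    using finite_field_generator by blast
  define n where "n = CARD('a) - 1"
  have n: "n > 0" using card_mono[of UNIV "{0, 1 :: 'a}"] by (simp add: n_def)
  obtain k where k: "a = \<gamma> ^ k" using \<gamma>(2) assms(1) by blast
  define \<omega> where "\<omega> = cis (2 * pi / real n)"
  have "\<omega> ^ n = 1" using n by (simp add: \<omega>_def DeMoivre)
  then obtain \<chi> where \<chi>: "mult_char \<chi>" "\<chi> \<gamma> = \<omega>"
    using ex_mult_char_of_generator[OF \<gamma>] n_def by metis
  have "\<gamma> ^ (k mod n) \<noteq> \<gamma> ^ 0"
    using assms(2) k generator_power_eq_iff[OF \<gamma>, of "k mod n" k] unfolding n_def by simp
  then have "k mod n \<noteq> 0" by (metis)
  have "\<omega> ^ (k mod n) = cis (2 * pi * real (k mod n) / real n)"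
    by (simp add: \<omega>_def DeMoivre mult_ac)
  moreover have "cis (2 * pi * real (k mod n) / real n) \<noteq> cis (2 * pi * real 0 / real n)"
    using inj_onD[OF bij_betw_imp_inj_on[OF bij_betw_roots_unity[OF n]], of "k mod n" 0] n
      \<open>k mod n \<noteq> 0\<close> by auto
  ultimately have "\<omega> ^ (k mod n) \<noteq> 1" by simp
  moreover have "\<omega> ^ k = \<omega> ^ (k mod n)"
    using power_mod_period[OF \<open>\<omega> ^ n = 1\<close>] by simp
  ultimately show ?thesis using that[OF \<chi>(1)] \<chi> k by (simp add: mult_char_power)
qed

text \<open>Evaluation at a generator is a bijection onto the roots of unity of order dividing
  \<open>CARD('a) - 1\<close>.\<close>

lemma card_mult_chars: "card {\<chi> :: 'a :: finite_field \<Rightarrow> complex. mult_char \<chi>} = CARD('a) - 1"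
proof -
  obtain \<gamma> :: 'a where \<gamma>: "\<gamma> \<noteq> 0" "\<And>x. x \<noteq> 0 \<Longrightarrow> \<exists>k. x = \<gamma> ^ k"
    using finite_field_generator by blast
  have n: "CARD('a) - 1 > 0" using card_mono[of UNIV "{0, 1 :: 'a}"] by simp
  have "bij_betw (\<lambda>\<chi>. \<chi> \<gamma>) {\<chi>. mult_char \<chi>} {z. z ^ (CARD('a) - 1) = 1}"
    unfolding bij_betw_def
  proof (intro conjI equalityI subsetI)
    show "inj_on (\<lambda>\<chi>. \<chi> \<gamma>) {\<chi>. mult_char \<chi>}"
    proof (rule inj_onI, rule ext)
      fix \<chi> \<psi> :: "'a \<Rightarrow> complex" and x
      assume *: "\<chi> \<in> {\<chi>. mult_char \<chi>}" "\<psi> \<in> {\<chi>. mult_char \<chi>}" "\<chi> \<gamma> = \<psi> \<gamma>"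
      show "\<chi> x = \<psi> x"
        using * \<gamma>(2)[of x] by (cases "x = 0") (auto simp: mult_char_power)
    qed
  next
    fix z assume "z \<in> (\<lambda>\<chi>. \<chi> \<gamma>) ` {\<chi>. mult_char \<chi>}"
    then obtain \<chi> where \<chi>: "mult_char \<chi>" "z = \<chi> \<gamma>" by blast
    then show "z \<in> {z. z ^ (CARD('a) - 1) = 1}"
      using mult_char_power[OF \<chi>(1), of \<gamma> "CARD('a) - 1"] power_CARD_minus_1[OF \<gamma>(1)] by simp
  next
    fix z :: complex assume "z \<in> {z. z ^ (CARD('a) - 1) = 1}"
    then show "z \<in> (\<lambda>\<chi>. \<chi> \<gamma>) ` {\<chi>. mult_char \<chi>}"
      using ex_mult_char_of_generator[OF \<gamma>, of z] by force
  qed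
  then show ?thesis
    using bij_betw_same_card card_roots_unity_eq[OF n] by metis
qed

text \<open>Multiplication by a character \<open>\<psi>\<close> with
  \<open>\<psi> a \<noteq> 1\<close> permutes the characters and multiplies the sum by
  \<open>\<psi> a\<close>.\<close>

lemma sum_mult_chars:
  fixes a :: "'a :: finite_field"
  shows "(\<Sum>\<chi> | mult_char \<chi>. \<chi> a) = (if a = 1 then of_nat CARD('a) - 1 else 0 :: complex)"
proof -
  consider "a = 0" | "a = 1" | "a \<noteq> 0" "a \<noteq> 1" by blast
  then show ?thesis
  proof cases
    case 2
    have "CARD('a) \<ge> 1" by (simp add: Suc_leI)
    then show ?thesis using 2 by (simp add: card_mult_chars)
  next
    case 3
    then obtain \<psi> where \<psi>: "mult_char \<psi>" "\<psi> a \<noteq> 1" by (rule ex_mult_char_separating)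
    have cancel: "\<psi> * (inverse \<psi> * \<chi>) = \<chi>" if "mult_char \<chi>" for \<chi>
      unfolding mult.assoc[symmetric] mult_char_times_inverse[OF \<psi>(1)]
      using mult_char_times_triv[OF that] by (simp add: mult.commute)
    have cancel': "inverse \<psi> * (\<psi> * \<chi>) = \<chi>" if "mult_char \<chi>" for \<chi>
      using cancel[OF that] by (simp add: mult.left_commute)
    have "(\<Sum>\<chi> | mult_char \<chi>. \<chi> a) = (\<Sum>\<chi> | mult_char \<chi>. (\<psi> * \<chi>) a)"
      by (rule sum.reindex_bij_witness[of _ "\<lambda>\<chi>. \<psi> * \<chi>" "\<lambda>\<chi>. inverse \<psi> * \<chi>"])
        (use \<psi>(1) cancel cancel' in auto)
    also have "\<dots> = \<psi> a * (\<Sum>\<chi> | mult_char \<chi>. \<chi> a)"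
      by (simp add: sum_distrib_left)
    finally show ?thesis using 3 \<psi>(2) by simp
  qed (auto intro: sum.neutral)
qed

section \<open>The quadratic character\<close>

lemma quad_char_unique:
  fixes \<chi> :: "'a :: finite_field \<Rightarrow> complex"
  assumes \<chi>: "mult_char \<chi>" "\<chi> ^ 2 = \<epsilon>" "\<chi> \<noteq> \<epsilon>"
  shows "\<chi> = \<phi>"
proof
  fix x
  obtain \<gamma> :: 'a where \<gamma>: "\<gamma> \<noteq> 0" "\<And>x. x \<noteq> 0 \<Longrightarrow> \<exists>k. x = \<gamma> ^ k"
    using finite_field_generator by blast
  have sq: "\<chi> y ^ 2 = 1" if "y \<noteq> 0" for y
    using fun_cong[OF \<chi>(2), of y] that by (simp add: triv_char_def)
  \<comment> \<open>The value at a generator must be \<open>-1\<close>. Squares then go to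
    \<open>1\<close>; a nonsquare is an odd power of the generator and goes to
    \<open>-1\<close>.\<close>
  have "\<chi> \<gamma> \<noteq> 1"
  proof
    assume "\<chi> \<gamma> = 1"
    then have "\<chi> y = 1" if "y \<noteq> 0" for y using \<gamma>(2)[OF that] \<chi>(1) by (auto simp: mult_char_power)
    then have "\<chi> = \<epsilon>" using \<chi>(1) by (auto simp: fun_eq_iff triv_char_def)
    with \<chi>(3) show False ..
  qed
  then have gen: "\<chi> \<gamma> = - 1" using sq[OF \<gamma>(1)] by (simp add: power2_eq_1_iff)
  show "\<chi> x = \<phi> x"
  proof (cases "x = 0")
    case False
    then obtain k where k: "x = \<gamma> ^ k" using \<gamma>(2) by blast
    show ?thesis
    proof (cases "\<exists>y. x = y ^ 2")
      case True
      then obtain y where "x = y ^ 2" by blast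
      then have "\<chi> x = 1" using False \<chi>(1) sq[of y] by (simp add: mult_char_power)
      moreover have "\<phi> x = 1" using False True by (simp add: quad_char_def)
      ultimately show ?thesis by simp
    next
      case nonsq: False
      have "odd k"
      proof
        assume "even k"
        then have "x = (\<gamma> ^ (k div 2)) ^ 2" by (simp add: k flip: power_mult)
        then show False using nonsq by blast
      qed
      then show ?thesis using False nonsq \<chi>(1) gen by (simp add: quad_char_def k mult_char_power)
    qed
  qed (use \<chi>(1) in \<open>simp add: quad_char_def\<close>)
qed

text \<open>The number of square roots of \<open>w\<close> is \<open>1 + \<phi> w\<close>; the two
  roots of a nonzero square differ because \<open>2 \<noteq> 0\<close>.\<close>

lemma sum_squares_eq_quad_char:
  fixes f :: "'a :: finite_field \<Rightarrow> complex"
  assumes "(2 :: 'a) \<noteq> 0"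
  shows "(\<Sum>y\<in>UNIV. f (y ^ 2)) = (\<Sum>w\<in>UNIV. f w * (1 + \<phi> w))"
proof -
  have card: "of_nat (card {y. y ^ 2 = w}) = 1 + \<phi> w" for w :: 'a
  proof -
    consider "w = 0" | y where "y \<noteq> 0" "w = y ^ 2" | "w \<noteq> 0" "\<nexists>y. w = y ^ 2"
      by fastforce
    then show ?thesis
    proof cases
      case 2
      have "{z. z ^ 2 = w} = {y, - y}" using 2 by (auto simp: power2_eq_iff)
      moreover have "y \<noteq> - y"
        using assms 2 by (metis add_eq_0_iff mult_2 mult_eq_0_iff)
      moreover have "\<phi> w = 1" using 2 unfolding quad_char_def by (metis power_eq_0_iff)
      ultimately show ?thesis by simp
    next
      case 3
      then have "{z. z ^ 2 = w} = {}" by blast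
      then show ?thesis using 3 by (simp add: quad_char_def)
    qed (simp add: quad_char_def)
  qed
  have "f w * (1 + \<phi> w) = (\<Sum>y | y \<in> UNIV \<and> y ^ 2 = w. f (y ^ 2))" for w
  proof -
    have "f w * (1 + \<phi> w) = f w * of_nat (card {y. y ^ 2 = w})"
      by (simp only: card)
    also have "\<dots> = (\<Sum>y | y ^ 2 = w. f w)" by (simp only: sum_constant mult.commute)
    finally show ?thesis by simp
  qed
  then have "(\<Sum>w\<in>UNIV. f w * (1 + \<phi> w)) = (\<Sum>w\<in>UNIV. \<Sum>y | y \<in> UNIV \<and> y ^ 2 = w. f (y ^ 2))"
    by (rule sum.cong[OF refl])
  also have "\<dots> = (\<Sum>y\<in>UNIV. f (y ^ 2))"
    by (rule sum.group) auto
  finally show ?thesis ..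
qed

lemma two_neq_0_of_odd_CARD:
  assumes "odd CARD('a :: finite_field)"
  shows "(2 :: 'a) \<noteq> 0"
proof
  assume "(2 :: 'a) = 0"
  then have "CHAR('a) dvd 2"
    by (metis of_nat_eq_0_iff_char_dvd of_nat_numeral)
  moreover have "prime CHAR('a)" by (rule prime_CHAR_semidom) (rule finite_imp_CHAR_pos, simp)
  ultimately have "CHAR('a) = 2" by (simp add: primes_dvd_imp_eq)
  then show False using CHAR_dvd_CARD[where 'a = 'a] assms by simp
qed

text \<open>Multiplicativity is not visible in the case distinction defining \<open>\<phi>\<close>.
  As \<open>CARD('a) - 1\<close> is even, some character sends a generator to \<open>-1\<close>, and
  uniqueness identifies it with \<open>\<phi>\<close>.\<close>

lemma
  assumes "odd CARD('a :: finite_field)"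
  shows mult_char_quad: "mult_char (\<phi> :: 'a \<Rightarrow> complex)"
    and quad_char_nontrivial: "(\<phi> :: 'a \<Rightarrow> complex) \<noteq> \<epsilon>"
proof -
  obtain \<gamma> :: 'a where \<gamma>: "\<gamma> \<noteq> 0" "\<And>x. x \<noteq> 0 \<Longrightarrow> \<exists>k. x = \<gamma> ^ k"
    using finite_field_generator by blast
  obtain \<chi> where \<chi>: "mult_char \<chi>" "\<chi> \<gamma> = - 1"
    using ex_mult_char_of_generator[OF \<gamma>, of "- 1"] assms by auto
  have "\<chi> ^ 2 = \<epsilon>"
  proof
    fix x
    show "(\<chi> ^ 2) x = \<epsilon> x"
    proof (cases "x = 0")
      case False
      then obtain k where "x = \<gamma> ^ k" using \<gamma>(2) by blast
      then have "\<chi> x ^ 2 = ((- 1) ^ k) ^ 2" using \<chi> by (simp add: mult_char_power[OF \<chi>(1)])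
      then show ?thesis using False by (simp add: triv_char_def flip: power_mult)
    qed (simp add: \<chi>(1) triv_char_def)
  qed
  moreover have "\<chi> \<noteq> \<epsilon>" using \<chi>(2) \<gamma>(1) by (auto simp: triv_char_def)
  ultimately have "\<chi> = \<phi>" by (intro quad_char_unique \<chi>(1))
  then show "mult_char (\<phi> :: 'a \<Rightarrow> complex)" "(\<phi> :: 'a \<Rightarrow> complex) \<noteq> \<epsilon>"
    using \<open>\<chi> \<noteq> \<epsilon>\<close> \<chi>(1) by simp_all
qed

lemma quad_char_times_self: "\<phi> * \<phi> = \<epsilon>"
  by (intro ext) (simp add: quad_char_def triv_char_def)

section \<open>Gauss and Jacobi sums\<close>

definition jacobi_sum :: "('a :: finite_field \<Rightarrow> complex) \<Rightarrow> ('a \<Rightarrow> complex) \<Rightarrow> complex" where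
  "jacobi_sum \<chi> \<psi> = (\<Sum>x\<in>UNIV. \<chi> x * \<psi> (1 - x))"

text \<open>All Gauss sum computations rest on these properties; the trace enters only when
  \<open>add_char\<close> is shown to have them.\<close>

locale nontrivial_additive_char =
  fixes \<theta> :: "'a :: finite_field \<Rightarrow> complex"
  assumes add: "\<theta> (x + y) = \<theta> x * \<theta> y"
    and zero: "\<theta> 0 = 1"
    and nontrivial: "\<exists>x. \<theta> x \<noteq> 1"
begin

definition gauss :: "('a \<Rightarrow> complex) \<Rightarrow> complex" where
  "gauss \<chi> = (\<Sum>x\<in>UNIV. \<chi> x * \<theta> x)"

text \<open>For \<open>c \<noteq> 0\<close>, translating \<open>w\<close> by \<open>a / c\<close>
  multiplies the sum by \<open>\<theta> a \<noteq> 1\<close>.\<close>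

lemma sum_scaled: "(\<Sum>w\<in>UNIV. \<theta> (w * c)) = (if c = 0 then of_nat CARD('a) else 0)"
proof (cases "c = 0")
  case False
  obtain a where a: "\<theta> a \<noteq> 1" using nontrivial ..
  have "(\<Sum>w\<in>UNIV. \<theta> (w * c)) = (\<Sum>w\<in>UNIV. \<theta> ((w + a / c) * c))"
    by (rule sum.reindex_bij_witness[of _ "\<lambda>w. w + a / c" "\<lambda>w. w - a / c"]) auto
  also have "\<dots> = \<theta> a * (\<Sum>w\<in>UNIV. \<theta> (w * c))"
    unfolding sum_distrib_left using False
    by (intro sum.cong) (simp_all add: distrib_right add mult.commute[of "\<theta> a"])
  finally show ?thesis using a False by simp
qed (simp add: zero)

lemma sum_scaled_nonzero:
  "(\<Sum>w\<in>UNIV. \<epsilon> w * \<theta> (w * c)) = (if c = 0 then of_nat CARD('a) else 0) - 1"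
proof -
  have "(\<Sum>w\<in>UNIV. \<epsilon> w * \<theta> (w * c)) = (\<Sum>w\<in>UNIV - {0}. \<theta> (w * c))"
    by (rule sum.mono_neutral_cong_right) (auto simp: triv_char_def)
  then show ?thesis by (simp add: sum_diff1 sum_scaled zero)
qed

lemma gauss_mult_gauss_inverse:
  assumes \<chi>: "mult_char \<chi>" "\<chi> \<noteq> \<epsilon>"
  shows "gauss \<chi> * gauss (inverse \<chi>) = \<chi> (- 1) * of_nat CARD('a)"
proof -
  note \<chi>_rules = mult_char_mult[OF \<chi>(1)] mult_char_inverse[OF \<chi>(1)] mult_char_0[OF \<chi>(1)] mult_char_eq_0_iff[OF \<chi>(1)]
  have "gauss \<chi> * gauss (inverse \<chi>) = (\<Sum>y\<in>UNIV. \<Sum>x\<in>UNIV. \<chi> x * inverse (\<chi> y) * \<theta> (x + y))"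
    unfolding gauss_def sum_product by (subst sum.swap) (simp add: add mult_ac)
  \<comment> \<open>Substitute \<open>x = z * y\<close>; the factor \<open>\<epsilon> y\<close>
    accounts for \<open>y = 0\<close>. In \<open>sum_scaled_nonzero\<close> the main value then
    occurs only at \<open>z = - 1\<close>, and the remaining \<open>- 1\<close> meets the vanishing
    sum of \<open>\<chi>\<close>.\<close>
  also have "\<dots> = (\<Sum>y\<in>UNIV. \<Sum>z\<in>UNIV. \<chi> z * (\<epsilon> y * \<theta> (y * (z + 1))))"
  proof (rule sum.cong[OF refl])
    fix y
    show "(\<Sum>x\<in>UNIV. \<chi> x * inverse (\<chi> y) * \<theta> (x + y)) = (\<Sum>z\<in>UNIV. \<chi> z * (\<epsilon> y * \<theta> (y * (z + 1))))"
    proof (cases "y = 0")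
      case False
      show ?thesis
        by (rule sum.reindex_bij_witness[of _ "\<lambda>z. z * y" "\<lambda>x. x / y"])
          (use False in \<open>auto simp: \<chi>_rules triv_char_def divide_inverse algebra_simps\<close>)
    qed (simp add: \<chi>_rules triv_char_def)
  qed
  also have "\<dots> = (\<Sum>z\<in>UNIV. \<chi> z * (\<Sum>y\<in>UNIV. \<epsilon> y * \<theta> (y * (z + 1))))"
    by (subst sum.swap) (simp add: sum_distrib_left)
  also have "\<dots> = (\<Sum>z\<in>UNIV. (if z = - 1 then \<chi> z * of_nat CARD('a) else 0)) - (\<Sum>z\<in>UNIV. \<chi> z)"
    unfolding sum_scaled_nonzero sum_subtractf[symmetric]
    by (rule sum.cong) (auto simp: right_diff_distrib eq_neg_iff_add_eq_0)
  also have "\<dots> = \<chi> (- 1) * of_nat CARD('a)"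
    by (simp add: sum_mult_char[OF \<chi>])
  finally show ?thesis .
qed

lemma gauss_neq_0:
  assumes \<chi>: "mult_char \<chi>" "\<chi> \<noteq> \<epsilon>"
  shows "gauss \<chi> \<noteq> 0"
  using gauss_mult_gauss_inverse[OF \<chi>] mult_char_eq_0_iff[OF \<chi>(1), of "- 1"] by auto

text \<open>Collect the product of the two Gauss sums by \<open>s = x + y\<close>. For
  \<open>s \<noteq> 0\<close>, scaling by \<open>s\<close> extracts
  \<open>(\<chi> * \<psi>) s\<close>; for \<open>s = 0\<close> the inner sum vanishes because
  \<open>\<chi> * \<psi>\<close> is nontrivial.\<close>

lemma jacobi_sum_mult_gauss:
  assumes \<chi>: "mult_char \<chi>" and \<psi>: "mult_char \<psi>" and nontriv: "\<chi> * \<psi> \<noteq> \<epsilon>"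
  shows "jacobi_sum \<chi> \<psi> * gauss (\<chi> * \<psi>) = gauss \<chi> * gauss \<psi>"
proof -
  note rules = mult_char_mult[OF \<chi>] mult_char_mult[OF \<psi>] mult_char_0[OF \<chi>] mult_char_0[OF \<psi>]
  have *: "(\<Sum>x\<in>UNIV. \<chi> x * \<psi> (s - x)) = (\<chi> * \<psi>) s * jacobi_sum \<chi> \<psi>" for s
  proof (cases "s = 0")
    case True
    have "\<chi> x * \<psi> (s - x) = \<psi> (- 1) * (\<chi> * \<psi>) x" for x
      using True rules(2)[of "- 1" x] by simp
    then have "(\<Sum>x\<in>UNIV. \<chi> x * \<psi> (s - x)) = \<psi> (- 1) * sum (\<chi> * \<psi>) UNIV"
      by (simp only: sum_distrib_left)
    also have "\<dots> = 0"
      using sum_mult_char[OF mult_char_times[OF \<chi> \<psi>] nontriv] by simp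
    finally show ?thesis using True by (simp add: rules)
  next
    case False
    have "(\<Sum>x\<in>UNIV. \<chi> x * \<psi> (s - x)) = (\<Sum>x\<in>UNIV. \<chi> (s * x) * \<psi> (s * (1 - x)))"
      by (rule sum.reindex_bij_witness[of _ "\<lambda>x. s * x" "\<lambda>x. x / s"])
        (use False in \<open>auto simp: algebra_simps\<close>)
    then show ?thesis
      by (simp add: jacobi_sum_def rules sum_distrib_left mult_ac)
  qed
  have "gauss \<chi> * gauss \<psi> = (\<Sum>x\<in>UNIV. \<Sum>y\<in>UNIV. \<chi> x * \<psi> y * \<theta> (x + y))"
    unfolding gauss_def sum_product by (simp add: add mult_ac)
  also have "\<dots> = (\<Sum>x\<in>UNIV. \<Sum>s\<in>UNIV. \<chi> x * \<psi> (s - x) * \<theta> s)"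
  proof (rule sum.cong[OF refl])
    fix x
    show "(\<Sum>y\<in>UNIV. \<chi> x * \<psi> y * \<theta> (x + y)) = (\<Sum>s\<in>UNIV. \<chi> x * \<psi> (s - x) * \<theta> s)"
      by (rule sum.reindex_bij_witness[of _ "\<lambda>s. s - x" "\<lambda>y. x + y"]) auto
  qed
  also have "\<dots> = (\<Sum>s\<in>UNIV. (\<Sum>x\<in>UNIV. \<chi> x * \<psi> (s - x)) * \<theta> s)"
    by (subst sum.swap) (simp add: sum_distrib_right)
  also have "\<dots> = jacobi_sum \<chi> \<psi> * gauss (\<chi> * \<psi>)"
    unfolding * gauss_def by (simp add: sum_distrib_left mult_ac)
  finally show ?thesis ..
qed

end

section \<open>The Hasse-Davenport relation for the quadratic character\<close>

lemma jacobi_sum_self: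
  fixes \<psi> :: "'a :: finite_field \<Rightarrow> complex"
  assumes "odd CARD('a)" and \<psi>: "mult_char \<psi>" "\<psi> \<noteq> \<epsilon>"
  shows "\<psi> 4 * jacobi_sum \<psi> \<psi> = jacobi_sum \<psi> \<phi>"
proof -
  have two: "(2 :: 'a) \<noteq> 0" by (rule two_neq_0_of_odd_CARD) fact
  have "\<psi> 4 * jacobi_sum \<psi> \<psi> = (\<Sum>x\<in>UNIV. \<psi> (4 * (x * (1 - x))))"
    by (simp add: jacobi_sum_def sum_distrib_left mult_char_mult[OF \<psi>(1)])
  \<comment> \<open>Complete the square: with \<open>y = 1 - 2 * x\<close>,
    \<open>4 * x * (1 - x) = 1 - y ^ 2\<close>.\<close>
  also have "\<dots> = (\<Sum>y\<in>UNIV. \<psi> (1 - y ^ 2))"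
    by (rule sum.reindex_bij_witness[of _ "\<lambda>y. (1 - y) / 2" "\<lambda>x. 1 - 2 * x"])
      (use two in \<open>auto simp: power2_eq_square diff_divide_distrib algebra_simps\<close>)
  also have "\<dots> = (\<Sum>w\<in>UNIV. \<psi> (1 - w) * (1 + \<phi> w))"
    by (rule sum_squares_eq_quad_char[OF two])
  also have "\<dots> = (\<Sum>w\<in>UNIV. \<psi> (1 - w)) + (\<Sum>w\<in>UNIV. \<psi> (1 - w) * \<phi> w)"
    by (simp add: distrib_left sum.distrib)
  also have "(\<Sum>w\<in>UNIV. \<psi> (1 - w)) = sum \<psi> UNIV"
    by (rule sum.reindex_bij_witness[of _ "\<lambda>w. 1 - w" "\<lambda>w. 1 - w"]) auto
  also have "\<dots> = 0" by (rule sum_mult_char[OF \<psi>])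
  also have "(\<Sum>w\<in>UNIV. \<psi> (1 - w) * \<phi> w) = jacobi_sum \<psi> \<phi>" unfolding jacobi_sum_def
    by (rule sum.reindex_bij_witness[of _ "\<lambda>w. 1 - w" "\<lambda>w. 1 - w"]) auto
  finally show ?thesis by simp
qed

text \<open>For \<open>\<psi> ^ 2 \<noteq> \<epsilon>\<close>, the Jacobi sums of
  \<open>\<psi>\<close> with itself and with \<open>\<phi>\<close> are both quotients of Gauss sums,
  and \<open>jacobi_sum_self\<close> compares them. For \<open>\<psi>\<close> equal to
  \<open>\<epsilon>\<close> or \<open>\<phi>\<close> both sides have the same factors, the value at
  \<open>4\<close> being \<open>1\<close>.\<close>

lemma (in nontrivial_additive_char) hasse_davenport_2:
  assumes odd: "odd CARD('a)" and \<psi>: "mult_char \<psi>"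
  shows "\<psi> 4 * gauss \<psi> * gauss (\<psi> * \<phi>) = gauss (\<psi> ^ 2) * gauss \<phi>"
proof -
  note \<phi> = mult_char_quad[OF odd] quad_char_nontrivial[OF odd]
  have two: "(2 :: 'a) \<noteq> 0" by (rule two_neq_0_of_odd_CARD) fact
  have "\<psi> 4 = \<psi> 2 ^ 2" using mult_char_power[OF \<psi>, of 2 2] by simp
  consider "\<psi> = \<epsilon>" | "\<psi> = \<phi>" | "\<psi> ^ 2 \<noteq> \<epsilon>"
    using quad_char_unique[OF \<psi>] by blast
  then show ?thesis
  proof cases
    case 1
    have "(4 :: 'a) \<noteq> 0" using two by (metis mult_2 mult_eq_0_iff numeral_Bit0)
    then have "\<epsilon> (4 :: 'a) = 1" by (simp add: triv_char_def)
    moreover have "(\<epsilon> :: 'a \<Rightarrow> complex) ^ 2 = \<epsilon>" "(\<epsilon> :: 'a \<Rightarrow> complex) * \<phi> = \<phi>"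
      using mult_char_times_triv[OF mult_char_triv] mult_char_times_triv[OF \<phi>(1)]
      by (simp_all add: power2_eq_square mult.commute)
    ultimately show ?thesis using 1 by simp
  next
    case 2
    have "\<phi> (4 :: 'a) = 1" using \<open>\<psi> 4 = \<psi> 2 ^ 2\<close> two by (simp add: 2 quad_char_def)
    then show ?thesis using 2 by (simp add: quad_char_times_self power2_eq_square)
  next
    case 3
    have nontriv: "\<psi> \<noteq> \<epsilon>" "\<psi> * \<phi> \<noteq> \<epsilon>"
    proof -
      show "\<psi> \<noteq> \<epsilon>"
        using 3 mult_char_times_triv[OF mult_char_triv] by (auto simp: power2_eq_square)
      show "\<psi> * \<phi> \<noteq> \<epsilon>"
      proof
        assume "\<psi> * \<phi> = \<epsilon>"
        then have "\<psi> * (\<phi> * \<phi>) = \<epsilon> * \<phi>" by (simp only: mult.assoc[symmetric])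
        then have "\<psi> = \<phi>"
          using mult_char_times_triv[OF \<psi>] mult_char_times_triv[OF \<phi>(1)]
          by (simp add: quad_char_times_self mult.commute)
        then show False using 3 by (simp add: quad_char_times_self power2_eq_square)
      qed
    qed
    have "jacobi_sum \<psi> \<psi> * gauss (\<psi> ^ 2) = gauss \<psi> * gauss \<psi>"
      using jacobi_sum_mult_gauss[OF \<psi> \<psi>] 3 by (simp add: power2_eq_square)
    then have "\<psi> 4 * (gauss \<psi> * gauss \<psi>) = (\<psi> 4 * jacobi_sum \<psi> \<psi>) * gauss (\<psi> ^ 2)"
      by simp
    also have "\<dots> = jacobi_sum \<psi> \<phi> * gauss (\<psi> ^ 2)"
      by (simp only: jacobi_sum_self[OF odd \<psi> nontriv(1)])
    finally have "gauss \<psi> * (\<psi> 4 * gauss \<psi> * gauss (\<psi> * \<phi>)) = (jacobi_sum \<psi> \<phi> * gauss (\<psi> * \<phi>)) * gauss (\<psi> ^ 2)"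
      by (simp add: mult_ac)
    also have "\<dots> = gauss \<psi> * (gauss (\<psi> ^ 2) * gauss \<phi>)"
      using jacobi_sum_mult_gauss[OF \<psi> \<phi>(1) nontriv(2)] by simp
    finally show ?thesis using gauss_neq_0[OF \<psi> nontriv(1)] by simp
  qed
qed

section \<open>The additive character of the trace\<close>

lemma CHAR_eq_of_CARD_prime_power:
  assumes "prime p" "CARD('a :: finite_field) = p ^ r"
  shows "CHAR('a) = p"
proof -
  have "prime CHAR('a)" by (rule prime_CHAR_semidom) (rule finite_imp_CHAR_pos, simp)
  moreover from this have "CHAR('a) dvd p"
    using CHAR_dvd_CARD[where 'a = 'a] unfolding assms(2) by (rule prime_dvd_power)
  ultimately show ?thesis using assms(1) by (simp add: primes_dvd_imp_eq)
qed

text \<open>The polynomial \<open>P\<close> has at most \<open>p\<close> roots, and the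
  \<open>p\<close> distinct images of \<open>0, ..., p - 1\<close> are roots. This will place the
  trace in the range of \<open>of_nat\<close>, so that the \<open>LEAST\<close> in
  \<open>add_char\<close> exists.\<close>

lemma prime_subfield_eq_frobenius_fixed:
  assumes "CHAR('a :: finite_field) = p"
  shows "{y :: 'a. y ^ p = y} = of_nat ` {..<p}"
proof -
  have p: "prime CHAR('a)" by (rule prime_CHAR_semidom) (rule finite_imp_CHAR_pos, simp)
  then have "p > 1" using assms prime_gt_1_nat by blast
  define P :: "'a poly" where "P = monom 1 p - [:0, 1:]"
  have P: "poly P y = y ^ p - y" for y by (simp add: P_def poly_monom)
  have "degree P \<le> p"
    unfolding P_def using \<open>p > 1\<close> by (intro degree_diff_le) (simp_all add: degree_monom_le)
  moreover have "coeff P p = 1"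
    using \<open>p > 1\<close> by (simp add: P_def coeff_pCons split: nat.split)
  then have "P \<noteq> 0" by auto
  ultimately have card: "card {y. poly P y = 0} \<le> p"
    using card_poly_roots_bound[of P] by linarith
  have sub: "of_nat ` {..<p} \<subseteq> {y. poly P y = 0}"
  proof safe
    fix k :: nat
    \<comment> \<open>Written as a sum of \<open>k\<close> ones, \<open>of_nat k\<close> is visibly
      fixed by the additive Frobenius map.\<close>
    have "(\<Sum>i<k. 1 :: 'a) ^ p = (\<Sum>i<k. 1 ^ p)"
      using assms p by (intro freshmans_dream_sum) simp_all
    then show "poly P (of_nat k) = 0" by (simp add: P)
  qed
  have "inj_on (of_nat :: nat \<Rightarrow> 'a) {..<p}"
    by (rule inj_onI) (simp add: of_nat_eq_iff_cong_CHAR assms cong_def)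
  then have "card (of_nat ` {..<p} :: 'a set) = p" by (simp add: card_image)
  then have "of_nat ` {..<p} = {y. poly P y = 0}"
    using card card_mono[OF _ sub] by (intro card_subset_eq sub) auto
  then show ?thesis by (auto simp: P)
qed

lemma abs_trace_add:
  assumes "prime p" "CHAR('a :: finite_field) = p"
  shows "abs_trace p r (x + y :: 'a) = abs_trace p r x + abs_trace p r y"
  unfolding abs_trace_def sum.distrib[symmetric]
  by (intro sum.cong refl freshmans_dream') (use assms in simp_all)

lemma abs_trace_power:
  fixes x :: "'a :: finite_field"
  assumes "prime p" "CARD('a) = p ^ r"
  shows "abs_trace p r x ^ p = abs_trace p r x"
proof -
  have "CHAR('a) = p" using CHAR_eq_of_CARD_prime_power[OF assms] .
  then have "abs_trace p r x ^ p = (\<Sum>i<r. (x ^ (p ^ i)) ^ p)"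
    unfolding abs_trace_def using assms(1) by (intro freshmans_dream_sum) simp_all
  also have "\<dots> = (\<Sum>i<r. x ^ (p ^ Suc i))"
    by (simp add: mult.commute flip: power_mult)
  \<comment> \<open>The shift loses the conjugate \<open>x\<close> and gains the one with
    \<open>i = r\<close>, which is again \<open>x\<close> because \<open>p ^ r\<close> is the
    cardinality.\<close>
  also have "\<dots> = (\<Sum>i<Suc r. x ^ (p ^ i)) - x"
    by (subst sum.lessThan_Suc_shift) simp
  also have "\<dots> = abs_trace p r x"
    using finite_field_power_card_eq_same[of x] by (simp add: abs_trace_def assms(2))
  finally show ?thesis .
qed

text \<open>The trace is a polynomial function of degree at most \<open>p ^ (r - 1)\<close>, too
  small to vanish on the whole field. The polynomial is nonzero since its linear coefficient comes
  from \<open>i = 0\<close> alone.\<close>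

lemma abs_trace_nontrivial:
  assumes "prime p" "CARD('a) = p ^ r"
  obtains x :: "'a :: finite_field" where "abs_trace p r x \<noteq> 0"
proof (rule ccontr)
  assume "\<not> thesis"
  then have zero: "abs_trace p r x = 0" for x :: 'a using that by blast
  have p: "p > 1" using assms(1) prime_gt_1_nat by blast
  have r: "r > 0"
    using assms(2) card_mono[of UNIV "{0, 1 :: 'a}"] by (cases r) auto
  define P :: "'a poly" where "P = (\<Sum>i<r. monom 1 (p ^ i))"
  have "poly P x = 0" for x
    using zero[of x] by (simp add: P_def poly_sum poly_monom abs_trace_def)
  moreover have "coeff P 1 = (\<Sum>i<r. if i = 0 then 1 else 0)"
    using p unfolding P_def coeff_sum by (intro sum.cong) (auto simp: one_less_power)
  then have "P \<noteq> 0" using r by auto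
  ultimately have "CARD('a) \<le> degree P" using card_poly_roots_bound[of P] by simp
  also have "degree P \<le> p ^ (r - 1)"
    unfolding P_def
    by (intro degree_sum_le) (use p in \<open>auto intro!: order.trans[OF degree_monom_le] power_increasing\<close>)
  also have "\<dots> < p ^ r" using p r by (intro power_strict_increasing) auto
  finally show False using assms(2) by simp
qed

text \<open>Representatives of the trace agree modulo \<open>p\<close> and
  \<open>\<zeta> ^ p = 1\<close>, so any of them may replace the least one. Additivity follows, as
  representatives can be added.\<close>

lemma add_char_eq:
  fixes x :: "'a :: finite_field"
  assumes "CHAR('a) = p" "\<zeta> ^ p = 1" "of_nat k = abs_trace p r x"
  shows "add_char p r \<zeta> x = \<zeta> ^ k"
proof -
  define l where "l = (LEAST k. of_nat k = abs_trace p r x)"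
  have "of_nat l = abs_trace p r x" unfolding l_def using assms(3) by (rule LeastI)
  then have "l mod p = k mod p"
    using assms(1) assms(3)[symmetric] by (simp add: of_nat_eq_iff_cong_CHAR cong_def)
  then have "\<zeta> ^ l = \<zeta> ^ k" using power_mod_period[OF assms(2), of l] power_mod_period[OF assms(2), of k] by simp
  then show ?thesis by (simp add: add_char_def l_def)
qed

lemma nontrivial_additive_char_add_char:
  assumes p: "prime p" and card: "CARD('a :: finite_field) = p ^ r"
    and \<zeta>: "primitive_root_of_unity p \<zeta>"
  shows "nontrivial_additive_char (add_char p r \<zeta> :: 'a \<Rightarrow> complex)"
proof -
  have CHAR: "CHAR('a) = p" using CHAR_eq_of_CARD_prime_power[OF p card] .
  have \<zeta>1: "\<zeta> ^ p = 1" using \<zeta> by (simp add: primitive_root_of_unity_def)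
  note eq = add_char_eq[OF CHAR \<zeta>1]
  have ex: "\<exists>k<p. of_nat k = abs_trace p r x" for x :: 'a
  proof -
    have "abs_trace p r x \<in> of_nat ` {..<p}"
      unfolding prime_subfield_eq_frobenius_fixed[OF CHAR, symmetric]
      using abs_trace_power[OF p card, of x] by (rule CollectI)
    then show ?thesis by auto
  qed
  show ?thesis
  proof
    fix x y :: 'a
    obtain k l where kl: "of_nat k = abs_trace p r x" "of_nat l = abs_trace p r y" using ex by metis
    then have "of_nat (k + l) = abs_trace p r (x + y)"
      by (simp add: abs_trace_add[OF p CHAR])
    then show "add_char p r \<zeta> (x + y) = add_char p r \<zeta> x * add_char p r \<zeta> y"
      using eq[OF kl(1)] eq[OF kl(2)] eq[of "k + l" r "x + y"] by (simp add: power_add)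
  next
    have "p > 0" using p prime_gt_0_nat by blast
    then have "of_nat 0 = abs_trace p r (0 :: 'a)" by (simp add: abs_trace_def power_0_left)
    from eq[OF this] show "add_char p r \<zeta> (0 :: 'a) = 1" by simp
  next
    obtain x :: 'a where x: "abs_trace p r x \<noteq> 0" using abs_trace_nontrivial[OF p card] .
    obtain k where k: "k < p" "of_nat k = abs_trace p r x" using ex by blast
    then have "k > 0" using x by (cases k) auto
    then have "\<zeta> ^ k \<noteq> 1" using \<zeta> k(1) by (simp add: primitive_root_of_unity_def)
    then have "add_char p r \<zeta> x \<noteq> 1" using eq[OF k(2)] by simp
    then show "\<exists>x :: 'a. add_char p r \<zeta> x \<noteq> 1" ..
  qed
qed

section \<open>The hypergeometric series\<close>

lemma mult_char_eqI:
  assumes "mult_char \<chi>" "mult_char \<psi>" "\<And>x. x \<noteq> 0 \<Longrightarrow> \<chi> x = \<psi> x"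
  shows "\<chi> = \<psi>"
  using assms by (intro ext) (metis mult_char_0)

lemma inverse_quad_char: "inverse \<phi> = \<phi>"
  by (intro ext) (simp add: quad_char_def)

context nontrivial_additive_char
begin

lemma gauss_quad_char_square:
  assumes "odd CARD('a)"
  shows "gauss \<phi> ^ 2 = \<phi> (- 1 :: 'a) * of_nat CARD('a)"
  using gauss_mult_gauss_inverse[OF mult_char_quad[OF assms] quad_char_nontrivial[OF assms]]
  by (simp add: inverse_quad_char power2_eq_square)

text \<open>Up to the factor in front, the binomial is the Jacobi sum of \<open>\<chi>\<close> and
  \<open>inverse \<psi>\<close>; the third hypothesis keeps the denominator nonzero.\<close>

lemma char_binom_conv_gauss:
  assumes "mult_char \<chi>" "mult_char \<psi>" "\<chi> * inverse \<psi> \<noteq> \<epsilon>"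
  shows "char_binom \<chi> \<psi> =
    \<psi> (- 1) / of_nat CARD('a) * (gauss \<chi> * gauss (inverse \<psi>) / gauss (\<chi> * inverse \<psi>))"
proof -
  have \<psi>': "mult_char (inverse \<psi>)" using assms(2) ..
  have "gauss (\<chi> * inverse \<psi>) \<noteq> 0"
    using gauss_neq_0[OF mult_char_times[OF assms(1) \<psi>'] assms(3)] .
  then have "jacobi_sum \<chi> (inverse \<psi>) = gauss \<chi> * gauss (inverse \<psi>) / gauss (\<chi> * inverse \<psi>)"
    using jacobi_sum_mult_gauss[OF assms(1) \<psi>' assms(3)] by (simp add: field_simps)
  then show ?thesis by (simp add: char_binom_def jacobi_sum_def)
qed

text \<open>
  In the triple sum over \<open>u\<close>, \<open>v\<close>, \<open>w\<close>, only \<open>w \<noteq> 0\<close> contributes, and \<open>u = w a\<close>, \<open>v = w b\<close>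
  removes \<open>w\<close> from all multiplicative characters.
\<close>

lemma gauss_product_expand:
  assumes B: "mult_char B" and \<chi>: "mult_char \<chi>"
  shows "\<chi> s * gauss (B * \<chi> ^ 4) * gauss (inverse (\<chi> ^ 2)) * gauss (inverse (B * \<chi> ^ 2)) =
    (\<Sum>w\<in>UNIV. \<Sum>a\<in>UNIV. \<Sum>b\<in>UNIV.
      \<chi> (s * a ^ 4 / b ^ 2) * (B a * (\<epsilon> w * \<theta> (w * (1 + a + b)))))"
proof -
  note rules = mult_char_mult[OF B] mult_char_inverse[OF B] mult_char_0[OF B]
    mult_char_mult[OF \<chi>] mult_char_inverse[OF \<chi>] mult_char_power[OF \<chi>] mult_char_0[OF \<chi>]
    mult_char_divide[OF \<chi>]
  have "\<chi> s * gauss (B * \<chi> ^ 4) * gauss (inverse (\<chi> ^ 2)) * gauss (inverse (B * \<chi> ^ 2)) =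
    (\<Sum>w\<in>UNIV. \<Sum>u\<in>UNIV. \<Sum>v\<in>UNIV.
      \<chi> s * (B u * \<chi> u ^ 4 * \<theta> u) * (inverse (\<chi> v ^ 2) * \<theta> v) * (inverse (B w * \<chi> w ^ 2) * \<theta> w))"
    unfolding gauss_def
    by (simp add: sum_distrib_left sum_distrib_right) (rule sum.cong[OF refl], rule sum.swap)
  also have "\<dots> = (\<Sum>w\<in>UNIV. \<Sum>a\<in>UNIV. \<Sum>b\<in>UNIV.
      \<chi> (s * a ^ 4 / b ^ 2) * (B a * (\<epsilon> w * \<theta> (w * (1 + a + b)))))"
  proof (rule sum.cong[OF refl])
    fix w :: 'a
    show "(\<Sum>u\<in>UNIV. \<Sum>v\<in>UNIV.
        \<chi> s * (B u * \<chi> u ^ 4 * \<theta> u) * (inverse (\<chi> v ^ 2) * \<theta> v) * (inverse (B w * \<chi> w ^ 2) * \<theta> w)) =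
      (\<Sum>a\<in>UNIV. \<Sum>b\<in>UNIV. \<chi> (s * a ^ 4 / b ^ 2) * (B a * (\<epsilon> w * \<theta> (w * (1 + a + b)))))"
    proof (cases "w = 0")
      case False
      have nz: "B w \<noteq> 0" "\<chi> w \<noteq> 0" using False mult_char_eq_0_iff[OF B] mult_char_eq_0_iff[OF \<chi>] by auto
      \<comment> \<open>The powers of \<open>\<chi> w\<close> cancel as
        \<open>4 - 2 - 2 = 0\<close>, those of \<open>B w\<close> as \<open>1 - 1 = 0\<close>. At
        \<open>b = 0\<close> both sides are \<open>0\<close> through
        \<open>inverse 0 = 0\<close>.\<close>
      have summand: "\<chi> s * (B (w * a) * \<chi> (w * a) ^ 4 * \<theta> (w * a)) * (inverse (\<chi> (w * b) ^ 2) * \<theta> (w * b)) *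
          (inverse (B w * \<chi> w ^ 2) * \<theta> w) = \<chi> (s * a ^ 4 / b ^ 2) * (B a * (\<epsilon> w * \<theta> (w * (1 + a + b))))"
        for a b
      proof -
        have "\<theta> (w * (1 + a + b)) = \<theta> w * \<theta> (w * a) * \<theta> (w * b)"
          by (simp add: distrib_left add)
        then show ?thesis
          using nz False by (cases "\<chi> b = 0")
            (simp_all add: rules triv_char_def power_mult_distrib field_simps power4_eq_xxxx power2_eq_square)
      qed
      show ?thesis
        unfolding summand[symmetric]
      proof (rule sum.reindex_bij_witness[of _ "\<lambda>a. w * a" "\<lambda>u. u / w"], goal_cases)
        case (5 u)
        show ?case
          by (rule sum.reindex_bij_witness[of _ "\<lambda>v. v / w" "\<lambda>b. w * b"])
            (use False in auto)
      qed (use False in auto)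
    qed (simp add: rules triv_char_def)
  qed
  finally show ?thesis .
qed

text \<open>With \<open>b = a ^ 2 * c\<close> the condition no longer involves \<open>a\<close>, and
  the sum of \<open>B\<close> splits off and vanishes. It disposes of the error term left by the
  missing \<open>w = 0\<close>.\<close>

lemma sum_fourth_power_ratio:
  fixes s :: 'a
  assumes B: "mult_char B" "B \<noteq> \<epsilon>"
  shows "(\<Sum>a\<in>UNIV. \<Sum>b\<in>UNIV. of_bool (s * a ^ 4 / b ^ 2 = 1) * B a) = 0"
proof -
  have "(\<Sum>b\<in>UNIV. of_bool (s * a ^ 4 / b ^ 2 = 1) * B a) = (\<Sum>c\<in>UNIV. of_bool (s / c ^ 2 = 1)) * B a" for a
  proof (cases "a = 0")
    case False
    have "(\<Sum>b\<in>UNIV. of_bool (s * a ^ 4 / b ^ 2 = 1) * B a) = (\<Sum>c\<in>UNIV. of_bool (s / c ^ 2 = 1) * B a)"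
      by (rule sum.reindex_bij_witness[of _ "\<lambda>c. a ^ 2 * c" "\<lambda>b. b / a ^ 2"])
        (use False in \<open>auto simp: power_mult_distrib power_divide power_mult[symmetric]\<close>)
    then show ?thesis by (simp add: sum_distrib_right)
  qed (simp add: mult_char_0[OF B(1)])
  then show ?thesis by (simp only: sum_distrib_left[symmetric] sum_mult_char[OF B] mult_zero_right)
qed

text \<open>After \<open>gauss_product_expand\<close>, orthogonality over \<open>\<chi>\<close>
  imposes \<open>s * a ^ 4 / b ^ 2 = 1\<close>, and the sum over \<open>w\<close> then imposes
  \<open>b = - 1 - a\<close>.\<close>

lemma sum_gauss_product:
  fixes s :: 'a
  assumes B: "mult_char B" "B \<noteq> \<epsilon>"
  shows "(\<Sum>\<chi> | mult_char \<chi>. \<chi> s * gauss (B * \<chi> ^ 4) * gauss (inverse (\<chi> ^ 2)) * gauss (inverse (B * \<chi> ^ 2))) =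
    (of_nat CARD('a) - 1) * of_nat CARD('a) * (\<Sum>a\<in>UNIV. of_bool (s * a ^ 4 / (1 + a) ^ 2 = 1) * B a)"
proof -
  let ?q = "of_nat CARD('a) :: complex"
  have orth: "(\<Sum>\<chi> | mult_char \<chi>. \<chi> c) = (?q - 1) * of_bool (c = 1)" for c :: 'a
    by (simp add: sum_mult_chars)
  have "(\<Sum>\<chi> | mult_char \<chi>. \<chi> s * gauss (B * \<chi> ^ 4) * gauss (inverse (\<chi> ^ 2)) * gauss (inverse (B * \<chi> ^ 2))) =
    (\<Sum>\<chi> | mult_char \<chi>. \<Sum>w\<in>UNIV. \<Sum>a\<in>UNIV. \<Sum>b\<in>UNIV.
      \<chi> (s * a ^ 4 / b ^ 2) * (B a * (\<epsilon> w * \<theta> (w * (1 + a + b)))))"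
    by (rule sum.cong[OF refl]) (rule gauss_product_expand, use B in auto)
  also have "\<dots> = (\<Sum>w\<in>UNIV. \<Sum>a\<in>UNIV. \<Sum>b\<in>UNIV.
      (\<Sum>\<chi> | mult_char \<chi>. \<chi> (s * a ^ 4 / b ^ 2)) * (B a * (\<epsilon> w * \<theta> (w * (1 + a + b)))))"
    unfolding sum_distrib_right
    apply (rule trans[OF sum.swap], rule sum.cong[OF refl])
    apply (rule trans[OF sum.swap], rule sum.cong[OF refl])
    apply (rule trans[OF sum.swap], rule refl)
    done
  also have "\<dots> = (?q - 1) * (\<Sum>w\<in>UNIV. \<Sum>a\<in>UNIV. \<Sum>b\<in>UNIV.
      of_bool (s * a ^ 4 / b ^ 2 = 1) * B a * (\<epsilon> w * \<theta> (w * (1 + a + b))))"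
    unfolding orth sum_distrib_left by (simp only: mult.assoc)
  also have "(\<Sum>w\<in>UNIV. \<Sum>a\<in>UNIV. \<Sum>b\<in>UNIV.
      of_bool (s * a ^ 4 / b ^ 2 = 1) * B a * (\<epsilon> w * \<theta> (w * (1 + a + b)))) =
    (\<Sum>a\<in>UNIV. \<Sum>b\<in>UNIV. of_bool (s * a ^ 4 / b ^ 2 = 1) * B a *
      (\<Sum>w\<in>UNIV. \<epsilon> w * \<theta> (w * (1 + a + b))))"
    unfolding sum_distrib_left
    apply (rule trans[OF sum.swap], rule sum.cong[OF refl])
    apply (rule trans[OF sum.swap], rule refl)
    done
  \<comment> \<open>The subtracted double sum comes from the \<open>- 1\<close> in
    \<open>sum_scaled_nonzero\<close> and is zero by \<open>sum_fourth_power_ratio\<close>.\<close>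
  also have "\<dots> = (\<Sum>a\<in>UNIV. \<Sum>b\<in>UNIV. of_bool (s * a ^ 4 / b ^ 2 = 1) * B a * (if b = - 1 - a then ?q else 0))
      - (\<Sum>a\<in>UNIV. \<Sum>b\<in>UNIV. of_bool (s * a ^ 4 / b ^ 2 = 1) * B a)"
  proof -
    have "1 + a + b = 0 \<longleftrightarrow> b = - 1 - a" for a b :: 'a
      by (auto simp: eq_diff_eq eq_neg_iff_add_eq_0 algebra_simps)
    then show ?thesis
      unfolding sum_scaled_nonzero sum_subtractf[symmetric] by (simp only: right_diff_distrib mult_1_right)
  qed
  also have "\<dots> = (\<Sum>a\<in>UNIV. of_bool (s * a ^ 4 / (- 1 - a) ^ 2 = 1) * B a * ?q)"
    unfolding sum_fourth_power_ratio[OF B]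
    by (simp only: mult_zero_right if_distrib[of "\<lambda>x. _ * x"] sum.delta finite UNIV_I if_True diff_zero)
  also have "\<dots> = ?q * (\<Sum>a\<in>UNIV. of_bool (s * a ^ 4 / (1 + a) ^ 2 = 1) * B a)"
  proof -
    have "(- 1 - a) ^ 2 = (1 + a) ^ 2" for a :: 'a by (simp add: power2_eq_square algebra_simps)
    then show ?thesis by (simp only: sum_distrib_left mult.commute[of _ ?q])
  qed
  finally show ?thesis by (simp only: mult.assoc)
qed

end

lemma fun_eqI_nonzero:
  assumes "f 0 = g 0" "\<And>x. x \<noteq> 0 \<Longrightarrow> f x = g x"
  shows "f = g"
  using assms by (intro ext) metis

lemma mult_char_eq_if_quotient_triv:
  assumes \<chi>: "mult_char \<chi>" and \<psi>: "mult_char \<psi>" and eq: "\<chi> * inverse \<psi> = \<epsilon>"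
  shows "\<chi> = \<psi>"
proof (rule fun_eqI_nonzero)
  fix x :: 'a assume x: "x \<noteq> 0"
  then have "\<chi> x * inverse (\<psi> x) = 1" using fun_cong[OF eq, of x] by (simp add: triv_char_def)
  then show "\<chi> x = \<psi> x" using mult_char_eq_0_iff[OF \<psi>, of x] x by (simp add: field_simps)
qed (use \<chi> \<psi> in simp)

lemma four_neq_0_of_odd_CARD:
  assumes "odd CARD('a :: finite_field)"
  shows "(4 :: 'a) \<noteq> 0"
  using two_neq_0_of_odd_CARD[OF assms] by (metis mult_2 mult_eq_0_iff numeral_Bit0)

text \<open>If \<open>C ^ 4\<close> were trivial, \<open>C ^ 2\<close> would be
  \<open>\<epsilon>\<close> or \<open>\<phi>\<close>. The former gives \<open>\<epsilon>\<close> or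
  \<open>\<phi>\<close> for \<open>C\<close>; the latter makes \<open>C * inverse D\<close> a
  character with trivial square, giving \<open>D\<close> or \<open>inverse D\<close>.\<close>

lemma mult_char_power4_nontrivial:
  fixes C D :: "'a :: finite_field \<Rightarrow> complex"
  assumes odd: "odd CARD('a)" and C: "mult_char C" and D: "mult_char D" "D ^ 2 = \<phi>"
    and notin: "C \<notin> {\<epsilon>, \<phi>, D, inverse D}"
  shows "C ^ 4 \<noteq> \<epsilon>"
proof
  assume "C ^ 4 = \<epsilon>"
  then have "(C ^ 2) ^ 2 = \<epsilon>" by (simp flip: power_mult)
  moreover have "C ^ 2 \<noteq> \<epsilon>"
    using quad_char_unique[OF C] notin by blast
  moreover have "mult_char (C ^ 2)" using C by (rule mult_char_power_fun) simp
  ultimately have C2: "C ^ 2 = \<phi>" by (intro quad_char_unique)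
  have nz: "C x \<noteq> 0" "D x \<noteq> 0" if "x \<noteq> 0" for x
    using that mult_char_eq_0_iff[OF C, of x] mult_char_eq_0_iff[OF D(1), of x] by simp_all
  have sq: "C x ^ 2 = \<phi> x" "D x ^ 2 = \<phi> x" for x
    using fun_cong[OF C2, of x] fun_cong[OF D(2), of x] by simp_all
  have "(C * inverse D) ^ 2 = \<epsilon>"
    using nz by (intro ext) (simp add: triv_char_def power_mult_distrib power_inverse sq quad_char_def)
  then consider "C * inverse D = \<epsilon>" | "C * inverse D = \<phi>"
    using quad_char_unique[OF mult_char_times[OF C mult_char_inverse_fun[OF D(1)]]] by blast
  then show False
  proof cases
    case 1
    then have "C = D" by (rule mult_char_eq_if_quotient_triv[OF C D(1)])
    then show False using notin by simp
  next
    case 2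
    \<comment> \<open>Here \<open>C = \<phi> * D = D ^ 3\<close>, and
      \<open>D ^ 4 = \<epsilon>\<close>.\<close>
    have "C = inverse D"
    proof (rule mult_char_eqI[OF C mult_char_inverse_fun[OF D(1)]])
      fix x :: 'a assume x: "x \<noteq> 0"
      then have "C x = \<phi> x * D x" using fun_cong[OF 2, of x] nz[of x] by (simp add: field_simps)
      moreover have "\<phi> x * D x ^ 2 = 1" using x by (simp add: sq quad_char_def)
      ultimately show "C x = inverse D x"
        using nz[OF x] by (simp add: field_simps power2_eq_square)
    qed
    then show False using notin by simp
  qed
qed

section \<open>The coefficients of the series and its collapse to a sum over a quartic\<close>

context nontrivial_additive_char
begin

text \<open>The eight Gauss sums in the numerators form four pairs for characters
  \<open>\<psi>\<close> and \<open>\<psi> * \<phi>\<close>. Four uses of Hasse-Davenport merge them;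
  two of the results again form such a pair, with \<open>\<psi> = C ^ 2 * \<chi> ^ 2\<close>, which
  the fifth use merges.\<close>

lemma greene_coefficient:
  fixes C D \<chi> :: "'a \<Rightarrow> complex"
  assumes odd: "odd CARD('a)" and C: "mult_char C" "C (- 1) = 1" and D: "mult_char D" "D ^ 2 = \<phi>"
    and notin: "C \<notin> {\<epsilon>, \<phi>, D, inverse D}" and \<chi>: "mult_char \<chi>"
  shows "char_binom (C * \<chi>) \<chi> * char_binom (C * \<phi> * \<chi>) (C ^ 2 * \<phi> * \<chi>) *
      char_binom (C * D * \<chi>) (C ^ 2 * \<chi>) * char_binom (C * inverse D * \<chi>) (\<phi> * \<chi>) =
    gauss \<phi> ^ 5 * \<phi> (2 :: 'a) / (of_nat CARD('a) ^ 5 * (gauss (C * D) * gauss (inverse C * D)) * C 2 ^ 4) *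
      (\<chi> (1 / 16) * (gauss (C ^ 4 * \<chi> ^ 4) * gauss (inverse (\<chi> ^ 2)) * gauss (inverse (C ^ 4 * \<chi> ^ 2))))"
proof -
  let ?q = "of_nat CARD('a) :: complex"
  note \<phi> = mult_char_quad[OF odd]
  have nz: "C x \<noteq> 0" "D x \<noteq> 0" "\<chi> x \<noteq> 0" "\<phi> x \<noteq> 0" if "x \<noteq> 0" for x
    using that mult_char_eq_0_iff[OF C(1)] mult_char_eq_0_iff[OF D(1)] mult_char_eq_0_iff[OF \<chi>]
      mult_char_eq_0_iff[OF \<phi>] by simp_all
  have D2: "D x ^ 2 = \<phi> x" for x using fun_cong[OF D(2), of x] by simp
  have \<phi>2: "\<phi> x * \<phi> x = 1" if "x \<noteq> 0" for x :: 'a using that by (simp add: quad_char_def)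
  have \<phi>_inv: "inverse (\<phi> x) = \<phi> x" for x :: 'a using fun_cong[OF inverse_quad_char, of x] by simp
  \<comment> \<open>\<open>D ^ 4 = \<epsilon>\<close>, so \<open>inverse D = D * \<phi>\<close>;
    this is what pairs \<open>C * D * \<chi>\<close> with
    \<open>C * inverse D * \<chi>\<close>.\<close>
  have DD\<phi>: "D x * (D x * \<phi> x) = 1" if "x \<noteq> 0" for x
  proof -
    have "D x * (D x * \<phi> x) = D x ^ 2 * \<phi> x" by (simp add: power2_eq_square)
    then show ?thesis using \<phi>2[OF that] by (simp add: D2)
  qed
  have D_inv: "inverse (D x) = D x * \<phi> x" if "x \<noteq> 0" for x
    using DD\<phi>[OF that] by (rule inverse_unique)
  have zero: "C 0 = 0" "D 0 = 0" "\<chi> 0 = 0" "\<phi> (0 :: 'a) = 0"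
    using C(1) D(1) \<chi> \<phi> by simp_all
  \<comment> \<open>The Gauss sums in the denominators of the binomials: \<open>\<chi>\<close>
    cancels from all of them. They are nonzero since \<open>C\<close> differs from
    \<open>\<epsilon>\<close>, \<open>D\<close> and \<open>inverse D\<close>.\<close>
  have e1: "C * \<chi> * inverse \<chi> = C"
    and e2: "C * \<phi> * \<chi> * inverse (C ^ 2 * \<phi> * \<chi>) = inverse C"
    and e3: "C * D * \<chi> * inverse (C ^ 2 * \<chi>) = inverse C * D"
    and e4: "C * inverse D * \<chi> * inverse (\<phi> * \<chi>) = C * D"
    by (rule fun_eqI_nonzero; simp add: zero nz \<phi>2 D_inv \<phi>_inv DD\<phi> power2_eq_square field_simps)+
  have nontriv: "C \<noteq> \<epsilon>" "inverse C \<noteq> \<epsilon>" "inverse C * D \<noteq> \<epsilon>" "C * D \<noteq> \<epsilon>"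
  proof -
    show "C \<noteq> \<epsilon>" using notin by simp
    show "inverse C \<noteq> \<epsilon>"
    proof
      assume "inverse C = \<epsilon>"
      then have "C = \<epsilon>" using mult_char_times_inverse[OF C(1)] mult_char_times_triv[OF C(1)] by simp
      then show False using notin by simp
    qed
    show "inverse C * D \<noteq> \<epsilon>"
      using mult_char_eq_if_quotient_triv[OF D(1) C(1)] notin by (auto simp: mult.commute)
    have "inverse (inverse D) = D" by (intro ext) simp
    then show "C * D \<noteq> \<epsilon>"
      using mult_char_eq_if_quotient_triv[OF C(1) mult_char_inverse_fun[OF D(1)]] notin by auto
  qed
  have \<phi>m1: "\<phi> (- 1 :: 'a) = 1"
    using D2[of "- 1"] mult_char_minus_1_square[OF D(1)] by simp
  have signs: "\<chi> (- 1) * (C ^ 2 * \<phi> * \<chi>) (- 1) * (C ^ 2 * \<chi>) (- 1) * (\<phi> * \<chi>) (- 1) = 1"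
    using mult_char_minus_1_square[OF \<chi>] by (simp add: \<phi>m1 C(2) power2_eq_square)
  define n where "n = gauss (C * D) * gauss (inverse C * D)"
  define P where "P = gauss (C * \<chi>) * gauss (inverse \<chi>) * (gauss (C * \<phi> * \<chi>) * gauss (inverse (C ^ 2 * \<phi> * \<chi>))) *
    (gauss (C * D * \<chi>) * gauss (inverse (C ^ 2 * \<chi>))) * (gauss (C * inverse D * \<chi>) * gauss (inverse (\<phi> * \<chi>)))"
  have mc: "mult_char (C * \<chi>)" "mult_char (C * \<phi> * \<chi>)" "mult_char (C ^ 2 * \<phi> * \<chi>)"
    "mult_char (C * D * \<chi>)" "mult_char (C ^ 2 * \<chi>)" "mult_char (C * inverse D * \<chi>)" "mult_char (\<phi> * \<chi>)"
    "mult_char (C ^ 2 * \<chi> ^ 2)"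
    by (intro mult_char_times mult_char_inverse_fun mult_char_power_fun C(1) D(1) \<chi> \<phi> zero_less_numeral)+
  have b: "char_binom (C * \<chi>) \<chi> = \<chi> (- 1) / ?q * (gauss (C * \<chi>) * gauss (inverse \<chi>) / gauss C)"
    "char_binom (C * \<phi> * \<chi>) (C ^ 2 * \<phi> * \<chi>) = (C ^ 2 * \<phi> * \<chi>) (- 1) / ?q *
      (gauss (C * \<phi> * \<chi>) * gauss (inverse (C ^ 2 * \<phi> * \<chi>)) / gauss (inverse C))"
    "char_binom (C * D * \<chi>) (C ^ 2 * \<chi>) = (C ^ 2 * \<chi>) (- 1) / ?q *
      (gauss (C * D * \<chi>) * gauss (inverse (C ^ 2 * \<chi>)) / gauss (inverse C * D))"
    "char_binom (C * inverse D * \<chi>) (\<phi> * \<chi>) = (\<phi> * \<chi>) (- 1) / ?q *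
      (gauss (C * inverse D * \<chi>) * gauss (inverse (\<phi> * \<chi>)) / gauss (C * D))"
    by (rule char_binom_conv_gauss[OF mc(1) \<chi>, unfolded e1, OF nontriv(1)]
        char_binom_conv_gauss[OF mc(2,3), unfolded e2, OF nontriv(2)]
        char_binom_conv_gauss[OF mc(4,5), unfolded e3, OF nontriv(3)]
        char_binom_conv_gauss[OF mc(6,7), unfolded e4, OF nontriv(4)])+
  have gC: "gauss C * gauss (inverse C) = ?q"
    using gauss_mult_gauss_inverse[OF C(1) nontriv(1)] C(2) by simp
  have "char_binom (C * \<chi>) \<chi> * char_binom (C * \<phi> * \<chi>) (C ^ 2 * \<phi> * \<chi>) *
      char_binom (C * D * \<chi>) (C ^ 2 * \<chi>) * char_binom (C * inverse D * \<chi>) (\<phi> * \<chi>) =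
    (\<chi> (- 1) * (C ^ 2 * \<phi> * \<chi>) (- 1) * (C ^ 2 * \<chi>) (- 1) * (\<phi> * \<chi>) (- 1)) * P /
      (?q ^ 4 * (gauss C * gauss (inverse C)) * n)"
    unfolding b P_def n_def by (simp add: power4_eq_xxxx mult_ac del: times_fun_apply)
  also have "\<dots> = P / (?q ^ 5 * n)"
    unfolding signs gC by (simp add: power_Suc2[symmetric] del: power_Suc)
  finally have coeff: "char_binom (C * \<chi>) \<chi> * char_binom (C * \<phi> * \<chi>) (C ^ 2 * \<phi> * \<chi>) *
      char_binom (C * D * \<chi>) (C ^ 2 * \<chi>) * char_binom (C * inverse D * \<chi>) (\<phi> * \<chi>) = P / (?q ^ 5 * n)" .

  let ?g = "gauss \<phi>" and ?G0 = "gauss (C ^ 4 * \<chi> ^ 4)" and ?G1 = "gauss (inverse (\<chi> ^ 2))"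
    and ?G2 = "gauss (inverse (C ^ 4 * \<chi> ^ 2))" and ?E1 = "gauss (C ^ 2 * \<chi> ^ 2)"
    and ?E2 = "gauss (C ^ 2 * \<chi> ^ 2 * \<phi>)"
  note four = nz[OF four_neq_0_of_odd_CARD[OF odd]]
  \<comment> \<open>The source of the factor \<open>\<phi> 2\<close>: \<open>D 4 = D 2 ^ 2\<close>,
    and \<open>D 4\<close> enters through Hasse-Davenport for \<open>C * D * \<chi>\<close>.\<close>
  have D4: "D 4 = \<phi> (2 :: 'a)" using mult_char_power[OF D(1), of 2 2] by (simp add: D2)
  have two: "(2 :: 'a) \<noteq> 0" by (rule two_neq_0_of_odd_CARD) fact
  have f1: "inverse \<chi> * \<phi> = inverse (\<phi> * \<chi>)" "(inverse \<chi>) ^ 2 = inverse (\<chi> ^ 2)"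
    and f2: "inverse (C ^ 2 * \<chi>) * \<phi> = inverse (C ^ 2 * \<phi> * \<chi>)"
      "inverse (C ^ 2 * \<chi>) ^ 2 = inverse (C ^ 4 * \<chi> ^ 2)"
    and f3: "C * \<chi> * \<phi> = C * \<phi> * \<chi>" "(C * \<chi>) ^ 2 = C ^ 2 * \<chi> ^ 2"
    and f4: "C * D * \<chi> * \<phi> = C * inverse D * \<chi>" "(C * D * \<chi>) ^ 2 = C ^ 2 * \<chi> ^ 2 * \<phi>"
    and f5: "(C ^ 2 * \<chi> ^ 2) ^ 2 = C ^ 4 * \<chi> ^ 4"
    by (rule fun_eqI_nonzero; simp add: zero nz \<phi>2 D_inv \<phi>_inv power_mult_distrib D2 power_inverse power_mult[symmetric])+
  have H1: "gauss (inverse \<chi>) * gauss (inverse (\<phi> * \<chi>)) = \<chi> 4 * ?G1 * ?g"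
    using hasse_davenport_2[OF odd mult_char_inverse_fun[OF \<chi>], unfolded f1] four by (simp add: field_simps)
  have H2: "gauss (inverse (C ^ 2 * \<chi>)) * gauss (inverse (C ^ 2 * \<phi> * \<chi>)) = C 4 ^ 2 * \<chi> 4 * ?G2 * ?g"
    using hasse_davenport_2[OF odd mult_char_inverse_fun[OF mc(5)], unfolded f2] four by (simp add: field_simps)
  have H3: "gauss (C * \<chi>) * gauss (C * \<phi> * \<chi>) = ?E1 * ?g / (C 4 * \<chi> 4)"
    using hasse_davenport_2[OF odd mc(1), unfolded f3] four by (simp add: field_simps)
  have H4: "gauss (C * D * \<chi>) * gauss (C * inverse D * \<chi>) = ?E2 * ?g / (C 4 * \<phi> (2 :: 'a) * \<chi> 4)"
    using hasse_davenport_2[OF odd mc(4), unfolded f4] four nz(4)[OF two]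
    by (simp add: D4 field_simps)
  have H5: "?E1 * ?E2 = ?G0 * ?g / (C 4 ^ 2 * \<chi> 4 ^ 2)"
    using hasse_davenport_2[OF odd mc(8), unfolded f5] four by (simp add: field_simps)
  define c where "c = \<chi> (1 / 16)"
  have alg: "u / (w * inverse c) * y = u / w * (c * y)" for u w y :: complex
    by (simp add: divide_inverse)
  have "P = (gauss (C * \<chi>) * gauss (C * \<phi> * \<chi>)) * (gauss (C * D * \<chi>) * gauss (C * inverse D * \<chi>)) *
    (gauss (inverse \<chi>) * gauss (inverse (\<phi> * \<chi>))) *
    (gauss (inverse (C ^ 2 * \<chi>)) * gauss (inverse (C ^ 2 * \<phi> * \<chi>)))"
    unfolding P_def by (simp only: mult_ac)
  \<comment> \<open>The powers of \<open>C 4\<close> and \<open>\<chi> 4\<close> from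
    \<open>H1\<close> to \<open>H4\<close> cancel, so \<open>C 2 ^ 4\<close> and the argument
    \<open>1 / 16\<close> come from \<open>H5\<close> alone.\<close>
  also have "\<dots> = (?E1 * ?E2) * (?g ^ 4 * ?G1 * ?G2 / \<phi> (2 :: 'a))"
    unfolding H1 H2 H3 H4 using four nz(4)[OF two] by (simp add: field_simps power2_eq_square power4_eq_xxxx)
  also have "\<dots> = ?g ^ 5 * \<phi> (2 :: 'a) / (C 4 ^ 2 * \<chi> 4 ^ 2) * (?G0 * ?G1 * ?G2)"
    unfolding H5 using four \<phi>2[OF two] \<phi>_inv[of 2]
    by (simp add: divide_inverse numeral_eq_Suc mult_ac)
  also have "C 4 ^ 2 = C 2 ^ 4" using mult_char_power[OF C(1), of 2 2] by simp
  also have "\<chi> 4 ^ 2 = inverse c"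
    using mult_char_power[OF \<chi>, of 4 2] mult_char_divide[OF \<chi>, of 1 16] \<chi> by (simp add: c_def)
  finally have "P = ?g ^ 5 * \<phi> (2 :: 'a) / C 2 ^ 4 * (c * (?G0 * ?G1 * ?G2))"
    by (simp only: alg)
  moreover have "u * v / w * y / m = u * v / (m * w) * y" for u v w y m :: complex
    by (simp add: field_simps)
  ultimately show ?thesis
    unfolding coeff n_def[symmetric] c_def[symmetric] by (simp only:)
qed

end

lemma greene_series_4_3:
  "greene_series [A0, A1, A2, A3] [B1, B2, B3] (t :: 'a :: finite_field) =
    of_nat CARD('a) / (of_nat CARD('a) - 1) *
      (\<Sum>\<chi> | mult_char \<chi>. char_binom (A0 * \<chi>) \<chi> * char_binom (A1 * \<chi>) (B1 * \<chi>) *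
        char_binom (A2 * \<chi>) (B2 * \<chi>) * char_binom (A3 * \<chi>) (B3 * \<chi>) * \<chi> t)"
proof -
  have "{1..3} = {1, 2, 3 :: nat}" by auto
  then show ?thesis by (simp add: greene_series_def mult.assoc)
qed

text \<open>Summing the coefficients is \<open>sum_gauss_product\<close> with
  \<open>B = C ^ 4\<close> and \<open>s = t / 16\<close>; a fractional linear substitution turns its
  condition on \<open>a\<close> into the quartic in \<open>y\<close>.\<close>

lemma (in nontrivial_additive_char) greene_series_eq_quartic_sum:
  fixes C D :: "'a \<Rightarrow> complex"
  assumes odd: "odd CARD('a)" and C: "mult_char C" "C (- 1) = 1" and D: "mult_char D" "D ^ 2 = \<phi>"
    and notin: "C \<notin> {\<epsilon>, \<phi>, D, inverse D}" and t: "t \<noteq> 0"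
  shows "greene_series [C, C * \<phi>, C * D, C * inverse D] [C ^ 2 * \<phi>, C ^ 2, \<phi>] t =
    \<phi> (2 :: 'a) / (gauss \<phi> * (gauss (C * D) * gauss (inverse C * D))) *
      (\<Sum>y | (y ^ 2 - 1) ^ 2 = t. inverse (C ^ 4) (1 + y))"
proof -
  let ?q = "of_nat CARD('a) :: complex"
  have two: "(2 :: 'a) \<noteq> 0" by (rule two_neq_0_of_odd_CARD) fact
  have four: "(4 :: 'a) \<noteq> 0" by (rule four_neq_0_of_odd_CARD) fact
  have sixteen: "(16 :: 'a) \<noteq> 0" using four mult_eq_0_iff[of 4 "4 :: 'a"] by simp
  have B: "mult_char (C ^ 4)" "C ^ 4 \<noteq> \<epsilon>"
    using mult_char_power_fun[OF C(1)] mult_char_power4_nontrivial[OF odd C(1) D notin] by simp_all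
  define n where "n = gauss (C * D) * gauss (inverse C * D)"
  define K where "K = gauss \<phi> ^ 5 * \<phi> (2 :: 'a) / (?q ^ 5 * n * C 2 ^ 4)"
  have "greene_series [C, C * \<phi>, C * D, C * inverse D] [C ^ 2 * \<phi>, C ^ 2, \<phi>] t =
    ?q / (?q - 1) * (\<Sum>\<chi> | mult_char \<chi>. K * (\<chi> (t / 16) * gauss (C ^ 4 * \<chi> ^ 4) * gauss (inverse (\<chi> ^ 2)) * gauss (inverse (C ^ 4 * \<chi> ^ 2))))"
    unfolding greene_series_4_3
  proof (intro arg_cong[of _ _ "(*) _"] sum.cong[OF refl], goal_cases)
    case (1 \<chi>)
    then have \<chi>: "mult_char \<chi>" by simp
    have "\<chi> (t / 16) = \<chi> (1 / 16) * \<chi> t" using mult_char_mult[OF \<chi>, of "1 / 16" t] by simp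
    then show ?case
      unfolding greene_coefficient[OF odd C D notin \<chi>] K_def n_def by (simp only: mult_ac)
  qed
  also have "\<dots> = ?q / (?q - 1) * (K * ((?q - 1) * ?q * (\<Sum>a\<in>UNIV. of_bool (t / 16 * a ^ 4 / (1 + a) ^ 2 = 1) * (C ^ 4) a)))"
    unfolding sum_distrib_left[symmetric] sum_gauss_product[OF B] ..
  also have "(\<Sum>a\<in>UNIV. of_bool (t / 16 * a ^ 4 / (1 + a) ^ 2 = 1) * (C ^ 4) a) =
    (\<Sum>y\<in>UNIV. of_bool ((y ^ 2 - 1) ^ 2 = t) * (C 2 ^ 4 * inverse (C ^ 4) (1 + y)))"
  \<comment> \<open>With \<open>a = - 2 / (1 + y)\<close>, \<open>a ^ 4 / (16 * (1 + a) ^ 2)\<close>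
    becomes \<open>1 / (y ^ 2 - 1) ^ 2\<close>. Division by zero matches \<open>a = 0\<close> with
    \<open>y = - 1\<close>, so this is a bijection of the whole field; both summands vanish
    there.\<close>
  proof (rule sum.reindex_bij_witness[of _ "\<lambda>y. - 2 / (1 + y)" "\<lambda>a. - 2 / a - 1"], goal_cases)
    case (5 a)
    define y where "y = - 2 / a - 1"
    show ?case
    proof (cases "a = 0")
      case False
      have y: "1 + y \<noteq> 0" "a = - 2 / (1 + y)" using False two by (simp_all add: y_def)
      have "1 + a = (y - 1) / (1 + y)" using y by (simp add: field_simps)
      then have "t / 16 * a ^ 4 / (1 + a) ^ 2 = t / (y ^ 2 - 1) ^ 2"
      proof -
        have "a ^ 4 = 16 / ((1 + y) ^ 2 * (1 + y) ^ 2)"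
          by (simp add: y(2) power_divide flip: power_add)
        moreover have "(1 + a) ^ 2 = (y - 1) ^ 2 / (1 + y) ^ 2"
          by (simp only: \<open>1 + a = (y - 1) / (1 + y)\<close> power_divide)
        moreover have "(y ^ 2 - 1) ^ 2 = (1 + y) ^ 2 * (y - 1) ^ 2"
          by (simp add: power2_eq_square algebra_simps)
        moreover have "t / 16 * (16 / (u * u)) / (v / u) = t / (u * v)" if "u \<noteq> 0" for u v
          using that sixteen by (cases "v = 0") (simp_all add: field_simps)
        ultimately show ?thesis using y(1) by (simp only: power_not_zero not_False_eq_True)
      qed
      \<comment> \<open>At \<open>y = 1\<close> the quotient is \<open>0\<close> by convention, and
        the equivalence holds because \<open>t \<noteq> 0\<close>.\<close>
      then have "(t / 16 * a ^ 4 / (1 + a) ^ 2 = 1) \<longleftrightarrow> (y ^ 2 - 1) ^ 2 = t"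
        using t by (auto simp: divide_eq_1_iff)
      moreover have "(C ^ 4) a = C 2 ^ 4 * inverse (C ^ 4) (1 + y)"
        using mult_char_divide[OF C(1), of "- 2" "1 + y"] mult_char_mult[OF C(1), of "- 1" 2] C(2)
        by (simp add: y(2) power_mult_distrib power_inverse divide_inverse[where 'a = complex])
      ultimately show ?thesis by (simp add: y_def)
    qed (use C(1) in simp)
  qed (use two in \<open>auto simp: field_simps\<close>)
  also have "\<dots> = C 2 ^ 4 * (\<Sum>y | (y ^ 2 - 1) ^ 2 = t. inverse (C ^ 4) (1 + y))"
    unfolding sum_distrib_left by (rule sum.mono_neutral_cong_right) auto
  \<comment> \<open>\<open>C 2 ^ 4\<close> cancels against \<open>K\<close>. As
    \<open>\<phi> (- 1) = 1\<close>, the cardinality is \<open>gauss \<phi> ^ 2\<close>, which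
    reduces the remaining powers to \<open>1 / gauss \<phi>\<close>.\<close>
  also have "?q / (?q - 1) * (K * ((?q - 1) * ?q * (C 2 ^ 4 * S))) = \<phi> (2 :: 'a) / (gauss \<phi> * n) * S" for S
  proof -
    have "?q - 1 \<noteq> 0" using card_mono[of UNIV "{0, 1 :: 'a}"] by (auto simp: card_insert_if)
    moreover have "C 2 \<noteq> 0" using two mult_char_eq_0_iff[OF C(1)] by simp
    moreover have "gauss \<phi> \<noteq> 0" using gauss_neq_0[OF mult_char_quad[OF odd] quad_char_nontrivial[OF odd]] .
    moreover have "\<phi> (- 1 :: 'a) = 1"
      using fun_cong[OF D(2), of "- 1"] mult_char_minus_1_square[OF D(1)] by simp
    then have "?q = gauss \<phi> ^ 2" using gauss_quad_char_square[OF odd] by simp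
    ultimately show ?thesis
      unfolding K_def by (simp add: divide_simps) (simp add: power_mult[symmetric] eval_nat_numeral mult_ac)
  qed
  finally show ?thesis unfolding n_def .
qed

section \<open>Solutions of the quartic equation\<close>

text \<open>The quartic can be rewritten as
  \<open>(y ^ 2 - (1 - 2 * x)) ^ 2 = x * (2 * y) ^ 2\<close>, and likewise for \<open>1 - x\<close>;
  division by \<open>2 * y\<close> exhibits the square roots.\<close>

lemma squares_of_quartic_root:
  fixes x y :: "'a :: field"
  assumes "(2 :: 'a) \<noteq> 0" "y \<noteq> 0" "(y ^ 2 - 1) ^ 2 = 4 * x * (1 - x)"
  shows "\<exists>z. x = z ^ 2" "\<exists>z. 1 - x = z ^ 2"
proof -
  have "(y ^ 2 - (1 - 2 * x)) ^ 2 - x * (2 * y) ^ 2 = (y ^ 2 - 1) ^ 2 - 4 * x * (1 - x)"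
    by (simp add: power2_eq_square algebra_simps)
  then have "x * (2 * y) ^ 2 = (y ^ 2 - (1 - 2 * x)) ^ 2"
    using assms(3) by simp
  then have "x = ((y ^ 2 - (1 - 2 * x)) / (2 * y)) ^ 2"
    unfolding power_divide using assms(1,2) by (metis mult_eq_0_iff nonzero_eq_divide_eq power_eq_0_iff)
  then show "\<exists>z. x = z ^ 2" ..
  have "(y ^ 2 + (1 - 2 * x)) ^ 2 - (1 - x) * (2 * y) ^ 2 = (y ^ 2 - 1) ^ 2 - 4 * x * (1 - x)"
    by (simp add: power2_eq_square algebra_simps)
  then have "(1 - x) * (2 * y) ^ 2 = (y ^ 2 + (1 - 2 * x)) ^ 2"
    using assms(3) by simp
  then have "1 - x = ((y ^ 2 + (1 - 2 * x)) / (2 * y)) ^ 2"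
    unfolding power_divide using assms(1,2) by (metis mult_eq_0_iff nonzero_eq_divide_eq power_eq_0_iff)
  then show "\<exists>z. 1 - x = z ^ 2" ..
qed

text \<open>Here \<open>2\<close> and \<open>x\<close> are inverse to each other.\<close>

lemma quad_char_two:
  fixes x :: "'a :: finite_field"
  assumes "1 - 2 * x = 0"
  shows "\<phi> (2 :: 'a) = \<phi> x"
proof -
  have x: "2 * x = 1" using assms by simp
  then have nz: "(2 :: 'a) \<noteq> 0" "x \<noteq> 0" by auto
  have "(\<exists>y :: 'a. 2 = y ^ 2) \<longleftrightarrow> (\<exists>y. x = y ^ 2)"
  proof
    assume "\<exists>y :: 'a. 2 = y ^ 2"
    then obtain y :: 'a where "2 = y ^ 2" ..
    then have "x = (x * y) ^ 2" using x by (simp add: power_mult_distrib power2_eq_square mult_ac)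
    then show "\<exists>y. x = y ^ 2" ..
  next
    assume "\<exists>y. x = y ^ 2"
    then obtain y where "x = y ^ 2" ..
    then have "(2 * y) ^ 2 = 2 * (2 * x)" by (simp add: power2_eq_square mult_ac)
    then have "2 = (2 * y) ^ 2" by (simp only: x mult_1_right)
    then show "\<exists>y. (2 :: 'a) = y ^ 2" ..
  qed
  then show ?thesis using nz by (simp add: quad_char_def)
qed

text \<open>When both square roots exist, the expanded product counts roots with multiplicity and
  exceeds the sum over the set by one term \<open>E 1 = 1\<close> if \<open>0\<close> is a root.
  When one is missing, the product is \<open>0\<close>, but \<open>0\<close> may still be a root;
  the sign of \<open>\<phi> 2\<close> covers both cases.\<close>

lemma quartic_sum_eq:
  fixes x :: "'a :: finite_field" and E :: "'a \<Rightarrow> complex"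
  assumes odd: "odd CARD('a)" and E: "mult_char E" and x: "x \<noteq> 0" "x \<noteq> 1"
    and sq: "\<And>y :: 'a. (\<exists>z. y = z ^ 2) \<Longrightarrow> sq y ^ 2 = y"
  shows "(\<Sum>y | (y ^ 2 - 1) ^ 2 = 4 * x * (1 - x). E ((1 + y) ^ 2)) =
    E 2 * ((1 + \<phi> (1 - x)) / 2) * ((1 + \<phi> x) / 2) * (E (1 + sq (1 - x)) + E (1 - sq (1 - x))) *
      (E (1 + sq x) + E (1 - sq x)) - \<phi> (2 :: 'a) * \<delta> (1 - 2 * x)"
proof -
  have two: "(2 :: 'a) \<noteq> 0" by (rule two_neq_0_of_odd_CARD) fact
  let ?S = "{y. (y ^ 2 - 1) ^ 2 = 4 * x * (1 - x)}"
  define f where "f y = E ((1 + y) ^ 2)" for y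
  have f0: "f 0 = 1" using E by (simp add: f_def)
  have zero_mem: "0 \<in> ?S \<longleftrightarrow> 1 - 2 * x = 0"
  proof -
    have "1 - 4 * x * (1 - x) = (1 - 2 * x) ^ 2" by (simp add: power2_eq_square algebra_simps)
    moreover have "0 \<in> ?S \<longleftrightarrow> 1 - 4 * x * (1 - x) = 0" by simp
    ultimately show ?thesis by simp
  qed
  show ?thesis
  proof (cases "(\<exists>z. x = z ^ 2) \<and> (\<exists>z. 1 - x = z ^ 2)")
    case True
    define c s where "c = sq (1 - x)" and "s = sq x"
    have cs: "c ^ 2 = 1 - x" "s ^ 2 = x" using True sq by (simp_all add: c_def s_def)
    then have nz: "c \<noteq> 0" "s \<noteq> 0" using x by auto
    have \<phi>: "\<phi> x = 1" "\<phi> (1 - x) = 1" using True x by (simp_all add: quad_char_def)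
    have f: "f (u + v) = E 2 * E (1 + u) * E (1 + v)" if "u ^ 2 = c ^ 2" "v ^ 2 = s ^ 2" for u v
    proof -
      have "(1 + (u + v)) ^ 2 - 2 * (1 + u) * (1 + v) = u ^ 2 + v ^ 2 - 1"
        by (simp add: power2_eq_square algebra_simps)
      then have "(1 + (u + v)) ^ 2 = 2 * (1 + u) * (1 + v)" using that cs by simp
      then show ?thesis by (simp only: f_def mult_char_mult[OF E])
    qed
    have prod: "E 2 * ((1 + \<phi> (1 - x)) / 2) * ((1 + \<phi> x) / 2) * (E (1 + c) + E (1 - c)) *
      (E (1 + s) + E (1 - s)) = f (c + s) + f (c - s) + f (- (c + s)) + f (- (c - s))"
      using f[of c s] f[of c "- s"] f[of "- c" "- s"] f[of "- c" s]
      by (simp add: \<phi> algebra_simps)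
    have S: "?S = {c + s, c - s, - (c + s), - (c - s)}"
    proof -
      have "(y ^ 2 - 1) ^ 2 = 4 * x * (1 - x) \<longleftrightarrow>
        y = c + s \<or> y = c - s \<or> y = - (c + s) \<or> y = - (c - s)" for y
      proof -
        have "(y ^ 2 - 1) ^ 2 = 4 * x * (1 - x) \<longleftrightarrow> (y - (c + s)) * (y - (c - s)) * (y + (c + s)) * (y + (c - s)) = 0"
        proof -
          have "(y ^ 2 - 1) ^ 2 - 4 * x * (1 - x) = (y - (c + s)) * (y - (c - s)) * (y + (c + s)) * (y + (c - s))"
          proof -
            have "(y ^ 2 - (c ^ 2 + s ^ 2)) ^ 2 - 4 * s ^ 2 * c ^ 2 =
              (y - (c + s)) * (y - (c - s)) * (y + (c + s)) * (y + (c - s))"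
              by (simp add: power2_eq_square algebra_simps)
            then show ?thesis by (simp add: cs)
          qed
          then show ?thesis by (metis eq_iff_diff_eq_0)
        qed
        then show ?thesis
          by (simp only: mult_eq_0_iff right_minus_eq eq_neg_iff_add_eq_0 disj_assoc)
      qed
      then show ?thesis by auto
    qed
    define a b where "a = c + s" and "b = c - s"
    have ab: "a \<noteq> b" "a \<noteq> - b"
      using nz two by (simp_all add: a_def b_def algebra_simps flip: mult_2)
    have neg: "u \<noteq> - u" if "u \<noteq> 0" for u :: 'a
      using that two by (metis add_eq_0_iff mult_2 mult_eq_0_iff)
    \<comment> \<open>The product \<open>c ^ 2 - s ^ 2\<close> detects the coincidences: since
      \<open>a\<close> and \<open>b\<close> differ and are not opposite, the four roots collide
      exactly when one of \<open>a\<close>, \<open>b\<close> is \<open>0\<close>.\<close>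
    have ab_eq: "a * b = 1 - 2 * x"
      using cs by (simp add: a_def b_def power2_eq_square algebra_simps)
    have "sum f {a, b, - a, - b} = f a + f b + f (- a) + f (- b) - \<phi> (2 :: 'a) * \<delta> (1 - 2 * x)"
    proof (cases "1 - 2 * x = 0")
      case False
      then have "a \<noteq> 0" "b \<noteq> 0" using ab_eq by auto
      then have "a \<notin> {b, - a, - b}" "b \<notin> {- a, - b}" "- a \<noteq> - b"
        using ab neg[of a] neg[of b] by auto
      then show ?thesis using False by (simp add: delta_def)
    next
      case half: True
      have "\<phi> (2 :: 'a) = 1" using quad_char_two[OF half] \<phi> by simp
      moreover have "a = 0 \<and> b \<noteq> 0 \<or> a \<noteq> 0 \<and> b = 0" using ab_eq half ab by auto
      then have "sum f {a, b, - a, - b} + f 0 = f a + f b + f (- a) + f (- b)"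
      proof
        assume *: "a = 0 \<and> b \<noteq> 0"
        then have "{a, b, - a, - b} = {0, b, - b}" by auto
        then show ?thesis using * neg[of b] by simp
      next
        assume *: "a \<noteq> 0 \<and> b = 0"
        then have "{a, b, - a, - b} = {0, a, - a}" by auto
        then show ?thesis using * neg[of a] by simp
      qed
      ultimately show ?thesis using half f0 by (simp add: delta_def eq_diff_eq)
    qed
    then show ?thesis
      unfolding S f_def[symmetric] prod[unfolded c_def s_def] a_def b_def c_def s_def .
  next
    case False
    then have "\<phi> x = - 1 \<or> \<phi> (1 - x) = - 1" using x by (auto simp: quad_char_def)
    then have prod: "E 2 * ((1 + \<phi> (1 - x)) / 2) * ((1 + \<phi> x) / 2) = 0" by auto
    have "?S \<subseteq> {0}" using squares_of_quartic_root[OF two] False by blast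
    then have S: "?S = (if 1 - 2 * x = 0 then {0} else {})" using zero_mem by auto
    \<comment> \<open>Now \<open>x = 1 - x\<close> is a nonsquare, so the delta term contributes
      \<open>+1\<close>, the value at the only root \<open>0\<close>.\<close>
    have "\<phi> (2 :: 'a) = - 1" if half: "1 - 2 * x = 0"
    proof -
      have eq: "1 - x = x" using half by (simp add: algebra_simps)
      show ?thesis
        using \<open>\<phi> x = - 1 \<or> \<phi> (1 - x) = - 1\<close>[unfolded eq] quad_char_two[OF half] by simp
    qed
    then show ?thesis unfolding S prod f_def[symmetric] by (simp add: f0 delta_def)
  qed
qed

section \<open>Characters of order four and the two evaluations\<close>

lemma square_eq_quad_char_of_char_order_4:
  fixes \<chi> :: "'a :: finite_field \<Rightarrow> complex"
  assumes "mult_char \<chi>" "char_order \<chi> = 4"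
  shows "\<chi> ^ 2 = \<phi>"
proof -
  let ?P = "\<lambda>n. n > 0 \<and> \<chi> ^ n = \<epsilon>"
  have q: "CARD('a) - 1 > 0" using card_mono[of UNIV "{0, 1 :: 'a}"] by simp
  \<comment> \<open>A positive exponent killing \<open>\<chi>\<close> exists, so the
    \<open>LEAST\<close> in \<open>char_order\<close> is attained; then \<open>\<chi> ^ 2\<close> is
    nontrivial with trivial square.\<close>
  have "(\<chi> ^ (CARD('a) - 1)) x = \<epsilon> x" for x
  proof (cases "x = 0")
    case False
    then have "(\<chi> ^ (CARD('a) - 1)) x = \<chi> (x ^ (CARD('a) - 1))"
      by (simp only: power_fun_apply mult_char_power[OF assms(1)])
    then show ?thesis
      using False assms(1) unfolding power_CARD_minus_1[OF False] by (simp add: triv_char_def)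
  qed (use q assms(1) in \<open>simp add: triv_char_def zero_power\<close>)
  then have "\<chi> ^ (CARD('a) - 1) = \<epsilon>" by (rule ext)
  then have "?P (char_order \<chi>)"
    unfolding char_order_def using q by (intro LeastI[of ?P "CARD('a) - 1"]) simp
  then have "\<chi> ^ 4 = \<epsilon>" using assms(2) by simp
  then have "(\<chi> ^ 2) ^ 2 = \<epsilon>" by (simp flip: power_mult)
  moreover have "\<not> ?P 2"
    by (rule not_less_Least) (unfold char_order_def[symmetric] assms(2), simp)
  then have "\<chi> ^ 2 \<noteq> \<epsilon>" by simp
  moreover have "mult_char (\<chi> ^ 2)" using assms(1) by (rule mult_char_power_fun) simp
  ultimately show ?thesis by (intro quad_char_unique)
qed

theorem theorem1p7:
  fixes p r :: nat and \<zeta> N :: complex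
    and A \<chi>4 :: "'a :: finite_field \<Rightarrow> complex"
    and sq :: "'a \<Rightarrow> 'a" and F :: "'a \<Rightarrow> complex" and g :: "('a \<Rightarrow> complex) \<Rightarrow> complex"
    and q :: nat and x :: 'a
  assumes "prime p" and "odd p" and "q = p ^ r" and "CARD('a) = q"
    and "q mod 4 = 1"
    and "primitive_root_of_unity p \<zeta>"
    and "mult_char \<chi>4" and "char_order \<chi>4 = 4"
    and "mult_char A" and "A ^ 2 \<notin> {\<epsilon>, \<phi>, \<chi>4, inverse \<chi>4}"
    and sq: "\<And>y. (\<exists>z. y = z ^ 2) \<Longrightarrow> sq y ^ 2 = y"
    and g: "g = gauss_sum p r \<zeta>"
    and N: "N = g (A ^ 2 * \<chi>4) * g (inverse (A ^ 2) * \<chi>4)"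
    and F: "F = greene_series [A ^ 2, A ^ 2 * \<phi>, A ^ 2 * \<chi>4, A ^ 2 * inverse \<chi>4]
                              [A ^ 4 * \<phi>, A ^ 4, \<phi>]"
    and "x \<noteq> 0" and "x \<noteq> 1"
  shows "F (4 * x * (1 - x)) =
      (inverse (A ^ 4) * \<phi>) 2 / (g \<phi> * N) * ((1 + \<phi> (1 - x)) / 2) * ((1 + \<phi> x) / 2)
        * (inverse (A ^ 4) (1 + sq (1 - x)) + inverse (A ^ 4) (1 - sq (1 - x)))
        * (inverse (A ^ 4) (1 + sq x) + inverse (A ^ 4) (1 - sq x))
      - (A ^ 2 * \<phi>) x * (inverse (A ^ 4) * \<phi>) 2 * inverse (A ^ 6) (x - 1) * g \<phi> / (of_nat q * N)
        * \<delta> ((1 - 2 * x) / (1 - x) ^ 2)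
    \<and> F (- (4 * x) / (1 - x) ^ 2) =
      (inverse (A ^ 4) * \<phi>) 2 / (g \<phi> * N) * ((1 + \<phi> (1 - x)) * (1 + \<phi> (x ^ 2 - x)) / 4)
        * (inverse (A ^ 4) (1 + 1 / sq (1 - x)) + inverse (A ^ 4) (1 - 1 / sq (1 - x)))
        * (inverse (A ^ 4) (1 + sq (x / (x - 1))) + inverse (A ^ 4) (1 - sq (x / (x - 1))))
      - (A ^ 2 * \<phi>) x * (inverse (A ^ 4) * \<phi>) 2 * (A ^ 4 * \<phi>) (x - 1) * g \<phi> / (of_nat q * N)
        * \<delta> (1 - x ^ 2)"
proof -
  define \<theta> :: "'a \<Rightarrow> complex" where "\<theta> = add_char p r \<zeta>"
  interpret nontrivial_additive_char \<theta>
    unfolding \<theta>_def by (rule nontrivial_additive_char_add_char) (use assms in simp_all)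
  have g_eq: "g = gauss"
    unfolding g by (intro ext) (simp only: gauss_sum_def gauss_def, simp only: \<theta>_def)
  have odd: "odd CARD('a)" using assms by simp
  have two: "(2 :: 'a) \<noteq> 0" by (rule two_neq_0_of_odd_CARD) fact
  have \<phi>: "mult_char (\<phi> :: 'a \<Rightarrow> complex)" using mult_char_quad[OF odd] .
  have \<phi>_sq: "\<phi> u * \<phi> u = 1" if "u \<noteq> 0" for u :: 'a using that by (simp add: quad_char_def)
  have A: "mult_char A" by fact
  define C where "C = A ^ 2"
  define E where "E = inverse (A ^ 4)"
  have C: "mult_char C" "C (- 1) = 1"
    using A mult_char_minus_1_square[OF A] by (auto simp: C_def)
  have D: "mult_char \<chi>4" "\<chi>4 ^ 2 = \<phi>"
    using assms square_eq_quad_char_of_char_order_4 by blast+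
  have notin: "C \<notin> {\<epsilon>, \<phi>, \<chi>4, inverse \<chi>4}" using assms unfolding C_def by blast
  have E: "mult_char E"
    unfolding E_def by (intro mult_char_inverse_fun mult_char_power_fun A) simp
  have A4: "A ^ 4 = C ^ 2" by (simp add: C_def flip: power_mult)
  have N_eq: "N = gauss (C * \<chi>4) * gauss (inverse C * \<chi>4)" by (simp only: N g_eq C_def)
  have "g \<phi> \<noteq> 0"
    unfolding g_eq using gauss_neq_0[OF \<phi> quad_char_nontrivial[OF odd]] .
  \<comment> \<open>\<open>\<phi>\<close> is the square of \<open>\<chi>4\<close>, whose value at
    \<open>- 1\<close> is a sign; hence \<open>g \<phi> ^ 2\<close> is \<open>q\<close>
    itself.\<close>
  have "\<phi> (- 1 :: 'a) = 1"
    using fun_cong[OF D(2), of "- 1"] mult_char_minus_1_square[OF D(1)] by simp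
  then have q: "of_nat q = g \<phi> ^ 2"
    unfolding g_eq gauss_quad_char_square[OF odd] using assms by simp
  define f where "f u = E (1 + u) + E (1 - u)" for u

  \<comment> \<open>Identity (i) with its delta coefficient simplified, for every admissible
    argument, so that it also applies at \<open>x / (x - 1)\<close>.\<close>
  have core: "F (4 * x * (1 - x)) =
      (E * \<phi>) 2 / (g \<phi> * N) * ((1 + \<phi> (1 - x)) / 2) * ((1 + \<phi> x) / 2) * f (sq (1 - x)) * f (sq x) -
        g \<phi> / (of_nat q * N) * \<delta> (1 - 2 * x)" if "x \<noteq> 0" "x \<noteq> 1" for x
  proof -
    have E_sq: "inverse (C ^ 4) (1 + y) = E ((1 + y) ^ 2)" for y
      unfolding mult_char_power[OF E] by (simp add: E_def C_def power_inverse flip: power_mult)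
    have "4 * x * (1 - x) \<noteq> 0" using that four_neq_0_of_odd_CARD[OF odd] by simp
    then have "F (4 * x * (1 - x)) = \<phi> (2 :: 'a) / (g \<phi> * N) *
      (\<Sum>y | (y ^ 2 - 1) ^ 2 = 4 * x * (1 - x). E ((1 + y) ^ 2))"
      unfolding E_sq[symmetric] F A4 N_eq g_eq C_def[symmetric]
      by (rule greene_series_eq_quartic_sum[OF odd C D notin])
    also have "(\<Sum>y | (y ^ 2 - 1) ^ 2 = 4 * x * (1 - x). E ((1 + y) ^ 2)) =
      E 2 * ((1 + \<phi> (1 - x)) / 2) * ((1 + \<phi> x) / 2) * f (sq (1 - x)) * f (sq x) -
        \<phi> (2 :: 'a) * \<delta> (1 - 2 * x)"
      unfolding f_def by (rule quartic_sum_eq[OF odd E that sq])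
    also have "\<phi> (2 :: 'a) / (g \<phi> * N) * (E 2 * ((1 + \<phi> (1 - x)) / 2) * ((1 + \<phi> x) / 2) * f (sq (1 - x)) * f (sq x) -
        \<phi> (2 :: 'a) * \<delta> (1 - 2 * x)) =
      (E * \<phi>) 2 / (g \<phi> * N) * ((1 + \<phi> (1 - x)) / 2) * ((1 + \<phi> x) / 2) * f (sq (1 - x)) * f (sq x) -
        (\<phi> (2 :: 'a) * \<phi> (2 :: 'a)) / (g \<phi> * N) * \<delta> (1 - 2 * x)"
      by (simp add: right_diff_distrib mult_ac)
    \<comment> \<open>\<open>\<phi> 2 ^ 2 = 1\<close> and \<open>q = g \<phi> ^ 2\<close>.\<close>
    also have "(\<phi> (2 :: 'a) * \<phi> (2 :: 'a)) / (g \<phi> * N) = g \<phi> / (of_nat q * N)"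
      using \<phi>_sq[OF two] \<open>g \<phi> \<noteq> 0\<close> by (simp add: q power2_eq_square)
    finally show ?thesis .
  qed

  \<comment> \<open>The delta terms live only at \<open>x = 1 / 2\<close> and
    \<open>x = - 1\<close>, where their character factors are expressed by \<open>A 2\<close> and
    \<open>A (- 1)\<close>; the sign \<open>m\<close> occurs to even powers, and the powers of
    \<open>a\<close> cancel.\<close>
  define a m where "a = A 2" and "m = A (- 1)"
  have a: "a \<noteq> 0" using two mult_char_eq_0_iff[OF A, of 2] by (simp add: a_def)
  have m: "m ^ 2 = 1" using mult_char_minus_1_square[OF A] by (simp add: m_def)
  then have m': "(m ^ 2) ^ 2 = 1" "(m ^ 2) ^ 3 = 1" by simp_all
  have A_half: "A (1 / 2) = inverse a" "A (- (1 / 2)) = m * inverse a" "A (- 2) = m * a"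
    using mult_char_divide[OF A, of 1 2] mult_char_mult[OF A, of "- 1" "1 / 2"]
      mult_char_mult[OF A, of "- 1" 2] A by (simp_all add: a_def m_def inverse_eq_divide)
  have E2: "E 2 = inverse (a ^ 4)" by (simp add: E_def a_def)
  have 1: "(A ^ 2 * \<phi>) x * (E * \<phi>) 2 * inverse (A ^ 6) (x - 1) * g \<phi> / (of_nat q * N)
        * \<delta> ((1 - 2 * x) / (1 - x) ^ 2) = g \<phi> / (of_nat q * N) * \<delta> (1 - 2 * x)"
  proof (cases "1 - 2 * x = 0")
    case True
    then have half: "x = 1 / 2" "x - 1 = - (1 / 2)" using two by (simp_all add: field_simps)
    have "(A ^ 2 * \<phi>) x * (E * \<phi>) 2 * inverse (A ^ 6) (x - 1) = 1"
    proof -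
      have "\<phi> (1 / 2 :: 'a) = \<phi> (2 :: 'a)" using quad_char_two[OF True] half by simp
      then have "(A ^ 2 * \<phi>) x * (E * \<phi>) 2 * inverse (A ^ 6) (x - 1) =
        (\<phi> (2 :: 'a) * \<phi> (2 :: 'a)) * (inverse a ^ 2 * inverse (a ^ 4) * inverse ((m * inverse a) ^ 6))"
        unfolding half(2) by (simp add: half(1) A_half E2)
      also have "(m * inverse a) ^ 6 = inverse a ^ 6"
        using m'(2) by (simp add: power_mult_distrib flip: power_mult)
      also have "inverse a ^ 2 * inverse (a ^ 4) * inverse (inverse a ^ 6) = 1"
        using a by (simp add: power_inverse field_simps)
      finally show ?thesis using \<phi>_sq[OF two] by simp
    qed
    then show ?thesis using True by (simp add: delta_def)
  qed (use \<open>x \<noteq> 1\<close> in \<open>simp add: delta_def\<close>)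

  have 2: "(A ^ 2 * \<phi>) x * (E * \<phi>) 2 * (A ^ 4 * \<phi>) (x - 1) * g \<phi> / (of_nat q * N) * \<delta> (1 - x ^ 2) =
    g \<phi> / (of_nat q * N) * \<delta> (1 - 2 * (x / (x - 1)))"
  proof -
    have "1 - 2 * (x / (x - 1)) = - (1 + x) / (x - 1)"
      using \<open>x \<noteq> 1\<close> by (simp add: field_simps)
    then have iff: "1 - 2 * (x / (x - 1)) = 0 \<longleftrightarrow> x = - 1"
      unfolding eq_neg_iff_add_eq_0
      using \<open>x \<noteq> 1\<close> by (simp only: divide_eq_0_iff neg_equal_0_iff_equal right_minus_eq add.commute simp_thms)
    have "1 - x ^ 2 = (1 - x) * (x + 1)" by (simp add: power2_eq_square algebra_simps)
    then have iff': "1 - x ^ 2 = 0 \<longleftrightarrow> x = - 1"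
      unfolding eq_neg_iff_add_eq_0 using \<open>x \<noteq> 1\<close> by simp
    show ?thesis
    proof (cases "x = - 1")
      case True
      have "(A ^ 2 * \<phi>) x * (E * \<phi>) 2 * (A ^ 4 * \<phi>) (x - 1) = 1"
      proof -
        have "\<phi> (- 2 :: 'a) = \<phi> (2 :: 'a)"
          using mult_char_mult[OF \<phi>, of "- 1" 2] \<open>\<phi> (- 1 :: 'a) = 1\<close> by simp
        moreover have "(m * a) ^ 4 = a ^ 4"
          using m'(1) by (simp add: power_mult_distrib flip: power_mult)
        ultimately have "(A ^ 2 * \<phi>) x * (E * \<phi>) 2 * (A ^ 4 * \<phi>) (x - 1) =
            inverse (a ^ 4) * \<phi> (2 :: 'a) * (a ^ 4 * \<phi> (2 :: 'a))"
          using m \<open>\<phi> (- 1 :: 'a) = 1\<close> by (simp add: True A_half E2 flip: m_def)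
        also have "\<dots> = \<phi> (2 :: 'a) * \<phi> (2 :: 'a)" using a by (simp add: field_simps)
        finally show ?thesis using \<phi>_sq[OF two] by simp
      qed
      then show ?thesis using iff iff' True by (simp add: delta_def)
    qed (use iff iff' in \<open>simp add: delta_def\<close>)
  qed

  \<comment> \<open>The involution \<open>x / (x - 1)\<close> sends \<open>1 - x\<close> to its
    inverse, hence \<open>4 * x * (1 - x)\<close> to the argument in (ii).\<close>
  define x' where "x' = x / (x - 1)"
  have x': "x' \<noteq> 0" "x' \<noteq> 1" using \<open>x \<noteq> 0\<close> \<open>x \<noteq> 1\<close> by (auto simp: x'_def field_simps)
  have one_minus: "1 - x' = 1 / (1 - x)" using \<open>x \<noteq> 1\<close> by (simp add: x'_def field_simps)
  have arg: "4 * x' * (1 - x') = - (4 * x) / (1 - x) ^ 2"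
  proof -
    have "x' = - (x / (1 - x))" unfolding x'_def by (simp only: minus_divide_right minus_diff_eq)
    then show ?thesis unfolding one_minus by (simp add: power2_eq_square)
  qed
  have \<phi>_inv: "inverse (\<phi> u) = \<phi> u" for u :: 'a by (simp add: quad_char_def)
  have \<phi>1: "\<phi> (1 - x') = \<phi> (1 - x)"
    unfolding one_minus mult_char_divide[OF \<phi>] using \<phi> \<phi>_inv[of "1 - x"] by (simp add: inverse_eq_divide)
  have \<phi>2: "\<phi> x' = \<phi> (x ^ 2 - x)"
  proof -
    have "x ^ 2 - x = x * (x - 1)" by (simp add: power2_eq_square algebra_simps)
    then show ?thesis
      unfolding x'_def mult_char_divide[OF \<phi>] using \<phi>_inv[of "x - 1"]
      by (simp add: mult_char_mult[OF \<phi>] divide_inverse[where 'a = complex])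
  qed
  \<comment> \<open>\<open>sq (1 - x')\<close> and \<open>1 / sq (1 - x)\<close> agree only up to
    sign, which the even function \<open>f\<close> ignores. If \<open>1 - x\<close> is a nonsquare,
    the factor \<open>1 + \<phi> (1 - x)\<close> is \<open>0\<close>.\<close>
  have f_sq: "(1 + \<phi> (1 - x)) * f (sq (1 - x')) = (1 + \<phi> (1 - x)) * f (1 / sq (1 - x))"
  proof (cases "\<exists>z. 1 - x = z ^ 2")
    case True
    then obtain z where z: "1 - x = z ^ 2" by blast
    then have "1 - x' = (1 / z) ^ 2" by (simp add: one_minus power_divide)
    then have "sq (1 - x') ^ 2 = 1 - x'" using sq by blast
    also have "\<dots> = (1 / sq (1 - x)) ^ 2" using sq[OF True] by (simp add: one_minus power_divide)
    finally have "sq (1 - x') = 1 / sq (1 - x) \<or> sq (1 - x') = - (1 / sq (1 - x))"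
      by (simp only: power2_eq_iff)
    then show ?thesis by (auto simp: f_def add.commute)
  qed (use \<open>x \<noteq> 1\<close> in \<open>simp add: quad_char_def\<close>)
  have "F (- (4 * x) / (1 - x) ^ 2) =
      (E * \<phi>) 2 / (g \<phi> * N) * ((1 + \<phi> (1 - x)) / 2) * ((1 + \<phi> (x ^ 2 - x)) / 2) * f (sq (1 - x')) * f (sq x') -
        g \<phi> / (of_nat q * N) * \<delta> (1 - 2 * x')"
    using core[OF x'] unfolding arg \<phi>1 \<phi>2 .
  also have "(E * \<phi>) 2 / (g \<phi> * N) * ((1 + \<phi> (1 - x)) / 2) * ((1 + \<phi> (x ^ 2 - x)) / 2) * f (sq (1 - x')) * f (sq x') =
    (E * \<phi>) 2 / (g \<phi> * N) / 4 * (1 + \<phi> (x ^ 2 - x)) * ((1 + \<phi> (1 - x)) * f (sq (1 - x'))) * f (sq x')"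
    by (simp add: mult_ac del: times_fun_apply)
  also have "\<dots> = (E * \<phi>) 2 / (g \<phi> * N) * ((1 + \<phi> (1 - x)) * (1 + \<phi> (x ^ 2 - x)) / 4) * f (1 / sq (1 - x)) * f (sq x')"
    unfolding f_sq by (simp add: mult_ac del: times_fun_apply)
  finally have ii: "F (- (4 * x) / (1 - x) ^ 2) =
    (E * \<phi>) 2 / (g \<phi> * N) * ((1 + \<phi> (1 - x)) * (1 + \<phi> (x ^ 2 - x)) / 4) * f (1 / sq (1 - x)) * f (sq x') -
      g \<phi> / (of_nat q * N) * \<delta> (1 - 2 * x')" .
  show ?thesis
    using core[OF \<open>x \<noteq> 0\<close> \<open>x \<noteq> 1\<close>] ii
    unfolding x'_def 1[symmetric] 2[symmetric] f_def E_def by blast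
qed

end
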